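(* Let $k$ and $n$ be positive integers with $n > k$ and let $j \leq n$ be a non-negative integer. If $j = n$, then $\mathrm{NC}(C_{n,k}^{(j)})$ is a void complex. If $k \leq j < n$, then $\mathrm{NC}(C_{n,k}^{(j)})$ is contractible. If $0 \leq j \leq k-1$, then $$\mathrm{NC}(C_{n,k}^{(j)})\simeq \begin{cases} \displaystyle\bigvee_{k-j} S^{2q} & \text{if } n=(q+1)(k+1) \text{ for some integer } q\ge 0,\\ S^{2q+1} & \text{if } n=(q+1)(k+1)+t \text{ for some integers } q\ge 0 \text{ and } t \text{ with } j <t \leq k,\\ * & \text{otherwise}. \end{cases}$$
   Context: A hypergraph $\mathcal{H}$ on a finite vertex set $V$ is a collection of distinct non-empty subsets of $V$, called edges. $W\subseteq V$ is a cover if it meets every edge, and a noncover otherwise; $\mathrm{NC}(\mathcal{H})$ is the simplicial complex on $V$ whose faces are the noncovers of $\mathcal{H}$ (its maximal faces are complements of edges). The void complex is $\emptyset$ (no faces at all). $X\simeq Y$ denotes homotopy equivalence, and $X\simeq *$ means $X$ is contractible. $\bigvee_{m} S^{d}$ is the wedge sum of $m$ copies of the $d$-dimensional sphere. Tight cycle: for $n\ge k+1$, $C_{n,k}$ is the hypergraph on $\mathbb{Z}_n$ with edges $\{s,s+1,\ldots,s+k-1\}$, $0\le s\le n-1$ (addition modulo $n$). For $0\le j\le n$, $C_{n,k}^{(j)}$ is the hypergraph on $\mathbb{Z}_n$ obtained from $C_{n,k}$ by deleting the $j$ edges $\{s,\dots,s+k-1\}$ with $0\le s\le j-1$. *)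

theory Defs
  imports "HOL-Analysis.Analysis"
begin

section \<open>Hypergraphs and noncover complexes\<close>

text \<open>A hypergraph is given by its vertex set \<open>V\<close> and its set \<open>E\<close> of edges.\<close>

definition hypergraph :: "'a set \<Rightarrow> 'a set set \<Rightarrow> bool" where
  "hypergraph V E \<longleftrightarrow> finite V \<and> (\<forall>e\<in>E. e \<subseteq> V \<and> e \<noteq> {})"

definition is_cover :: "'a set set \<Rightarrow> 'a set \<Rightarrow> bool" where
  "is_cover E W \<longleftrightarrow> (\<forall>e\<in>E. W \<inter> e \<noteq> {})"

definition noncover_complex :: "'a set \<Rightarrow> 'a set set \<Rightarrow> 'a set set" where
  "noncover_complex V E = {W. W \<subseteq> V \<and> \<not> is_cover E W}"

text \<open>The vertex set \<open>\<int>\<^sub>n\<close> is represented by the residues \<open>{..<n}\<close>.\<close>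

definition tight_edge :: "nat \<Rightarrow> nat \<Rightarrow> nat \<Rightarrow> nat set" where
  "tight_edge n k s = (\<lambda>i. (s + i) mod n) ` {..<k}"

definition tight_cycle :: "nat \<Rightarrow> nat \<Rightarrow> nat set set" where
  "tight_cycle n k = tight_edge n k ` {..<n}"

text \<open>For \<open>0 < k < n\<close> the edges \<open>tight_edge n k s\<close> with \<open>s < n\<close> are pairwise distinct, so the
  difference removes exactly \<open>j\<close> edges when \<open>j \<le> n\<close>.\<close>

definition tight_cycle_del :: "nat \<Rightarrow> nat \<Rightarrow> nat \<Rightarrow> nat set set" where
  "tight_cycle_del n k j = tight_cycle n k - tight_edge n k ` {..<j}"

lemma hypergraph_tight_cycle_del:
  assumes "0 < k" "k < n"
  shows "hypergraph {..<n} (tight_cycle_del n k j)"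
  using assms by (auto simp: hypergraph_def tight_cycle_del_def tight_cycle_def tight_edge_def)


section \<open>Geometric realization\<close>

text \<open>Points are barycentric coordinates supported on a face. For a complex on finitely many
  vertices the subspace topology of the product topology is the usual one. The void complex and
  the complex whose only face is empty both have empty realization.\<close>

definition geometric_realization :: "'a set set \<Rightarrow> ('a \<Rightarrow> real) topology" where
  "geometric_realization K =
     subtopology (powertop_real UNIV)
       {x. (\<forall>v. 0 \<le> x v) \<and> {v. x v \<noteq> 0} \<in> K \<and> (\<Sum>v | x v \<noteq> 0. x v) = 1}"

text \<open>The predicate \<open>contractible_space\<close> holds of the empty space, which is excluded here.\<close>

definition contractible_complex :: "'a set set \<Rightarrow> bool" where
  "contractible_complex K \<longleftrightarrow>
     topspace (geometric_realization K) \<noteq> {} \<and> contractible_space (geometric_realization K)"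


section \<open>Wedge sums\<close>

text \<open>The wedge sum of pointed spaces \<open>(X i, p i)\<close> is the quotient of their disjoint union that
  identifies all base points. The common base point is \<open>None\<close>; every other point \<open>x\<close> of \<open>X i\<close>
  is \<open>Some (i, x)\<close>. The empty wedge is a point.\<close>

definition wedge_proj :: "('i \<Rightarrow> 'a) \<Rightarrow> 'i \<times> 'a \<Rightarrow> ('i \<times> 'a) option" where
  "wedge_proj p = (\<lambda>(i, x). if x = p i then None else Some (i, x))"

definition wedge_sum ::
    "('i \<Rightarrow> 'a topology) \<Rightarrow> ('i \<Rightarrow> 'a) \<Rightarrow> 'i set \<Rightarrow> ('i \<times> 'a) option topology" where
  "wedge_sum X p I = topology (\<lambda>U.
     U \<subseteq> insert None (wedge_proj p ` topspace (sum_topology X I)) \<and>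
     openin (sum_topology X I) {z \<in> topspace (sum_topology X I). wedge_proj p z \<in> U})"

lemma openin_wedge_sum:
  "openin (wedge_sum X p I) U \<longleftrightarrow>
     U \<subseteq> insert None (wedge_proj p ` topspace (sum_topology X I)) \<and>
     openin (sum_topology X I) {z \<in> topspace (sum_topology X I). wedge_proj p z \<in> U}"
proof -
  let ?S = "sum_topology X I"
  let ?pre = "\<lambda>U. {z \<in> topspace ?S. wedge_proj p z \<in> U}"
  have Int: "?pre (U \<inter> V) = ?pre U \<inter> ?pre V" for U V by blast
  have Un: "?pre (\<Union>\<K>) = \<Union> (?pre ` \<K>)" for \<K> by blast
  have "istopology (\<lambda>U. U \<subseteq> insert None (wedge_proj p ` topspace ?S) \<and> openin ?S (?pre U))"
    unfolding istopology_def
  proof (intro conjI allI impI)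
    fix \<K> assume *: "\<forall>U\<in>\<K>. U \<subseteq> insert None (wedge_proj p ` topspace ?S) \<and> openin ?S (?pre U)"
    then show "\<Union>\<K> \<subseteq> insert None (wedge_proj p ` topspace ?S)" by blast
    show "openin ?S (?pre (\<Union>\<K>))" unfolding Un using * by blast
  qed (auto simp only: Int intro: openin_Int)
  then show ?thesis
    unfolding wedge_sum_def by (simp only: topology_inverse')
qed

lemma topspace_wedge_sum:
  "topspace (wedge_sum X p I) = insert None (wedge_proj p ` topspace (sum_topology X I))"
proof
  show "topspace (wedge_sum X p I) \<subseteq> insert None (wedge_proj p ` topspace (sum_topology X I))"
    using openin_wedge_sum openin_topspace by blast
  have "{z \<in> topspace (sum_topology X I).
      wedge_proj p z \<in> insert None (wedge_proj p ` topspace (sum_topology X I))}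
      = topspace (sum_topology X I)"
    by blast
  then have "openin (wedge_sum X p I) (insert None (wedge_proj p ` topspace (sum_topology X I)))"
    by (simp only: openin_wedge_sum openin_topspace subset_refl simp_thms)
  then show "insert None (wedge_proj p ` topspace (sum_topology X I)) \<subseteq> topspace (wedge_sum X p I)"
    by (rule openin_subset)
qed

lemma quotient_map_wedge_proj:
  assumes "I \<noteq> {}" "\<And>i. i \<in> I \<Longrightarrow> p i \<in> topspace (X i)"
  shows "quotient_map (sum_topology X I) (wedge_sum X p I) (wedge_proj p)"
proof -
  obtain i where i: "i \<in> I" using assms(1) by blast
  then have "(i, p i) \<in> topspace (sum_topology X I)" "wedge_proj p (i, p i) = None"
    using assms(2) by (auto simp: wedge_proj_def)
  then have "None \<in> wedge_proj p ` topspace (sum_topology X I)" by (metis imageI)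
  then have eq: "topspace (wedge_sum X p I) = wedge_proj p ` topspace (sum_topology X I)"
    unfolding topspace_wedge_sum by blast
  then show ?thesis
    unfolding quotient_map_def openin_wedge_sum
    by (metis topspace_wedge_sum)
qed

definition sphere_base :: "nat \<Rightarrow> real" where
  "sphere_base = (\<lambda>i. if i = 0 then 1 else 0)"

definition wedge_of_spheres :: "nat \<Rightarrow> nat \<Rightarrow> (nat \<times> (nat \<Rightarrow> real)) option topology" where
  "wedge_of_spheres m d = wedge_sum (\<lambda>_. nsphere d) (\<lambda>_. sphere_base) {..<m}"

lemma sphere_base_in_nsphere: "sphere_base \<in> topspace (nsphere d)"
  unfolding sphere_base_def by (rule in_topspace_nsphere)

end

theory Submission
  imports Defs
begin

text \<open>Write \<open>K\<^sub>s\<close> for the noncover complex of the windows starting at \<open>s, \<dots>, n - 1\<close>. For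
  \<open>s \<ge> k\<close> it is a cone. For \<open>s < k\<close> the faces in \<open>K\<^sub>s - K\<^sub>s\<^sub>+\<^sub>1\<close>, read from position \<open>s + k\<close>
  onwards, are the \<open>W \<subseteq> {0, \<dots>, n - k - 1}\<close> whose blocks \<open>{p, \<dots>, p + k - 1}\<close> cover an initial
  interval. Repeatedly toggling the last admissible vertex matches these faces acyclically, with at
  most one critical face: one of dimension \<open>2q\<close> if \<open>n = (q + 1)(k + 1)\<close>, one of dimension
  \<open>2q + 1\<close> if \<open>n = (q + 1)(k + 1) + s + 1\<close>, none otherwise. In the first case the boundaries of all
  critical faces already lie in the contractible complex \<open>K\<^sub>k\<close>, so \<open>K\<^sub>j\<close> collapses to \<open>K\<^sub>k\<close>
  with \<open>k - j\<close> cells of dimension \<open>2q\<close> attached.\<close>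

section \<open>Realizations and collapses\<close>

text \<open>Stage \<open>s\<close> asks for blocks starting below \<open>L = n - k\<close> that
  cover \<open>{..<L + c}\<close>, with overhang \<open>c = k - 1 - s\<close>. A covering that needs
  its top block \<open>L - 1\<close> is, after removing that block, a covering for length
  \<open>L + c - k\<close> and overhang \<open>k - 1 - c\<close>. Two such rounds restore
  \<open>c\<close>, shorten \<open>L\<close> by \<open>k + 1\<close> and put two vertices into every
  critical face: hence the period \<open>k + 1\<close> in \<open>n\<close> and the steps of two in
  the dimension. The recursion can end in a critical face only at \<open>L = 1\<close>. Reaching it
  after an even number of rounds depends on \<open>n\<close> alone, so every stage then gives a
  cell; an odd number forces \<open>s = t - 1\<close>, a single stage. The obstacle is that cells of
  early stages sit on complexes which later stages still collapse. Boundaries inside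
  \<open>K\<^sub>k\<close>, which no collapse touches, keep those cells intact, and the
  contractibility of \<open>K\<^sub>k\<close> then turns them into a wedge.\<close>

definition simplicial_complex :: "'a set set \<Rightarrow> bool" where
  "simplicial_complex K \<longleftrightarrow>
     finite K \<and> (\<forall>\<sigma>\<in>K. finite \<sigma>) \<and> (\<forall>\<sigma>\<in>K. \<forall>\<tau>. \<tau> \<subseteq> \<sigma> \<longrightarrow> \<tau> \<in> K)"

lemma simplicial_complex_mono:
  "simplicial_complex K \<Longrightarrow> \<sigma> \<in> K \<Longrightarrow> \<tau> \<subseteq> \<sigma> \<Longrightarrow> \<tau> \<in> K"
  by (auto simp: simplicial_complex_def)

text \<open>Lets all sums run over a fixed face \<sigma> containing the support; the support itself
  may change while a point moves.\<close>

lemma in_realization: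
  assumes "\<sigma> \<in> K" "finite \<sigma>"
    and "\<And>v. v \<notin> \<sigma> \<Longrightarrow> x v = 0" "{v. x v \<noteq> 0} \<in> K"
  shows "x \<in> topspace (geometric_realization K) \<longleftrightarrow> (\<forall>v\<in>\<sigma>. 0 \<le> x v) \<and> (\<Sum>v\<in>\<sigma>. x v) = 1"
proof -
  have "(\<Sum>v\<in>\<sigma>. x v) = (\<Sum>v | x v \<noteq> 0. x v)"
    using assms by (intro sum.mono_neutral_right) auto
  moreover have "(\<forall>v\<in>\<sigma>. 0 \<le> x v) \<longleftrightarrow> (\<forall>v. 0 \<le> x v)"
    using assms(3) by (metis order_refl)
  ultimately show ?thesis
    using assms(4) by (auto simp: geometric_realization_def)
qed

lemma realization_ge_0: "x \<in> topspace (geometric_realization K) \<Longrightarrow> 0 \<le> x v"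
  by (auto simp: geometric_realization_def)

lemma realization_support: "x \<in> topspace (geometric_realization K) \<Longrightarrow> {v. x v \<noteq> 0} \<in> K"
  by (auto simp: geometric_realization_def)

lemma realization_sum:
  assumes "x \<in> topspace (geometric_realization K)" "{v. x v \<noteq> 0} \<subseteq> V" "finite V"
  shows "(\<Sum>v\<in>V. x v) = 1"
proof -
  have "(\<Sum>v\<in>V. x v) = (\<Sum>v | x v \<noteq> 0. x v)"
    using assms by (intro sum.mono_neutral_right) auto
  then show ?thesis using assms(1) by (auto simp: geometric_realization_def)
qed

lemma realization_mono:
  assumes "L \<subseteq> K" "x \<in> topspace (geometric_realization L)"
  shows "x \<in> topspace (geometric_realization K)"
  using assms by (auto simp: geometric_realization_def)

lemma realization_subcomplex:
  assumes "x \<in> topspace (geometric_realization K)" "{v. x v \<noteq> 0} \<in> L"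
  shows "x \<in> topspace (geometric_realization L)"
  using assms by (auto simp: geometric_realization_def)

lemma continuous_map_coordinate:
  assumes "continuous_map X (geometric_realization K) f"
  shows "continuous_map X euclideanreal (\<lambda>x. f x v)"
  using assms
  by (simp add: geometric_realization_def continuous_map_in_subtopology continuous_map_componentwise_UNIV)

lemma continuous_map_realization_coordinate:
  "continuous_map (geometric_realization K) euclideanreal (\<lambda>x. x v)"
  using continuous_map_coordinate[of "geometric_realization K" K id] by simp

lemma continuous_map_into_realization:
  assumes "\<And>v. continuous_map X euclideanreal (\<lambda>x. f x v)"
    and "\<And>x. x \<in> topspace X \<Longrightarrow> f x \<in> topspace (geometric_realization K)"
  shows "continuous_map X (geometric_realization K) f"
  using assms
  by (auto simp: geometric_realization_def continuous_map_in_subtopology continuous_map_componentwise_UNIV)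

lemma continuous_map_realization_mono:
  assumes "L \<subseteq> K" "continuous_map X (geometric_realization L) f"
  shows "continuous_map X (geometric_realization K) f"
proof (rule continuous_map_into_realization)
  show "f x \<in> topspace (geometric_realization K)" if "x \<in> topspace X" for x
    using that assms(2) realization_mono[OF assms(1)] continuous_map_image_subset_topspace by blast
qed (rule continuous_map_coordinate[OF assms(2)])

lemma continuous_map_Min:
  fixes f :: "'b \<Rightarrow> 'a \<Rightarrow> real"
  assumes "finite S" "S \<noteq> {}" "\<And>i. i \<in> S \<Longrightarrow> continuous_map X euclideanreal (f i)"
  shows "continuous_map X euclideanreal (\<lambda>x. Min ((\<lambda>i. f i x) ` S))"
  using assms by (induction S rule: finite_ne_induct) (auto intro!: continuous_intros)

text \<open>The segment from \<open>f x\<close> to \<open>g x\<close> lies in the one simplex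
  spanned by both supports, so the coordinatewise convex combination never leaves the
  realization.\<close>

lemma homotopic_straight_line:
  assumes K: "simplicial_complex K"
    and f: "continuous_map X (geometric_realization K) f"
    and g: "continuous_map X (geometric_realization K) g"
    and fg: "\<And>x. x \<in> topspace X \<Longrightarrow> {v. f x v \<noteq> 0} \<union> {v. g x v \<noteq> 0} \<in> K"
  shows "homotopic_with (\<lambda>_. True) X (geometric_realization K) f g"
proof -
  define h where "h = (\<lambda>(t::real, x) v. (1 - t) * f x v + t * g x v)"
  have "continuous_map (prod_topology (top_of_set {0..1}) X) (geometric_realization K) h"
  proof (rule continuous_map_into_realization)
    fix v
    have t: "continuous_map (prod_topology (top_of_set {0..1}) X) euclideanreal fst"
      using continuous_map_fst continuous_map_into_fulltopology by blast
    have "continuous_map (prod_topology (top_of_set {0..1::real}) X) euclideanreal (\<lambda>z. F (snd z) v)"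
      if "continuous_map X (geometric_realization K) F" for F
      using continuous_map_compose[OF continuous_map_snd continuous_map_coordinate[OF that]]
      by (simp add: o_def)
    from t this[OF f] this[OF g]
    show "continuous_map (prod_topology (top_of_set {0..1}) X) euclideanreal (\<lambda>z. h z v)"
      unfolding h_def case_prod_unfold
      by (intro continuous_map_add continuous_map_real_mult continuous_map_diff) auto
  next
    fix z assume "z \<in> topspace (prod_topology (top_of_set {0..1::real}) X)"
    then obtain t x where z: "z = (t, x)" and t: "0 \<le> t" "t \<le> 1" and x: "x \<in> topspace X"
      by auto
    let ?S = "{v. f x v \<noteq> 0} \<union> {v. g x v \<noteq> 0}"
    have S: "?S \<in> K" "finite ?S" using fg[OF x] K by (auto simp: simplicial_complex_def)
    have fx: "f x \<in> topspace (geometric_realization K)" and gx: "g x \<in> topspace (geometric_realization K)"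
      using f g x continuous_map_image_subset_topspace by blast+
    have "{v. h z v \<noteq> 0} \<subseteq> ?S" by (auto simp: h_def z)
    then have "{v. h z v \<noteq> 0} \<in> K" using simplicial_complex_mono[OF K] S by blast
    moreover have "sum (f x) ?S = 1" "sum (g x) ?S = 1"
      using fx gx S(2) by (auto intro!: realization_sum)
    then have "sum (h z) ?S = 1"
      by (simp add: h_def z sum.distrib flip: sum_distrib_left)
    moreover have "0 \<le> h z v" for v
      using t realization_ge_0[OF fx, of v] realization_ge_0[OF gx, of v] by (simp add: h_def z)
    ultimately show "h z \<in> topspace (geometric_realization K)"
      using S by (subst in_realization[of ?S]) (auto simp: h_def z)
  qed
  moreover have "h (0, x) = f x" "h (1, x) = g x" for x by (auto simp: h_def)
  ultimately show ?thesis unfolding homotopic_with_def by blast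
qed

text \<open>Every point is joined by a segment to the apex \<open>v\<close>: its support together
  with \<open>v\<close> is a face.\<close>

lemma contractible_cone:
  assumes K: "simplicial_complex K" "K \<noteq> {}" and v: "\<And>\<rho>. \<rho> \<in> K \<Longrightarrow> insert v \<rho> \<in> K"
  shows "contractible_complex K"
proof -
  have v': "{v} \<in> K" using K v by (metis empty_subsetI ex_in_conv insert_subset insertI1 simplicial_complex_mono)
  define a :: "'a \<Rightarrow> real" where "a = (\<lambda>w. if w = v then 1 else 0)"
  have supp: "{w. a w \<noteq> 0} = {v}" by (auto simp: a_def)
  then have a: "a \<in> topspace (geometric_realization K)"
    using v' by (subst in_realization[of "{v}"]) (auto simp: a_def)
  have "homotopic_with (\<lambda>_. True) (geometric_realization K) (geometric_realization K) id (\<lambda>x. a)"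
  proof (rule homotopic_straight_line[OF K(1)])
    fix x assume "x \<in> topspace (geometric_realization K)"
    then show "{v. id x v \<noteq> 0} \<union> {v. a v \<noteq> 0} \<in> K"
      unfolding supp using v[OF realization_support] by simp
  qed (use a in auto)
  then show ?thesis using a by (auto simp: contractible_complex_def contractible_space_def)
qed

text \<open>The retraction moves weight from all vertices of \<open>\<sigma>\<close> to \<open>v\<close> until one of them has none left.\<close>

lemma collapse:
  assumes K: "simplicial_complex K" and \<sigma>: "\<sigma> \<noteq> {}" "v \<notin> \<sigma>"
    and ins: "\<And>\<rho>. \<rho> \<in> K \<Longrightarrow> \<sigma> \<subseteq> \<rho> \<Longrightarrow> insert v \<rho> \<in> K"
  shows "geometric_realization K homotopy_equivalent_space
         geometric_realization {\<rho>\<in>K. \<not> \<sigma> \<subseteq> \<rho>}"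
proof (cases "\<sigma> \<in> K")
  case False
  then have "{\<rho>\<in>K. \<not> \<sigma> \<subseteq> \<rho>} = K" using simplicial_complex_mono[OF K] by blast
  then show ?thesis by (simp add: homotopy_equivalent_space_refl)
next
  case True
  then have fin: "finite \<sigma>" using K by (auto simp: simplicial_complex_def)
  let ?L = "{\<rho>\<in>K. \<not> \<sigma> \<subseteq> \<rho>}"
  let ?X = "geometric_realization K" and ?Y = "geometric_realization ?L"
  define m where "m x = Min (x ` \<sigma>)" for x :: "'a \<Rightarrow> real"
  \<comment> \<open>Each vertex of \<sigma> loses \<open>m x\<close>, so \<open>v\<close> must gain
    \<open>card \<sigma>\<close> times as much for the total to stay 1. Where the support does not
    contain \<sigma>, \<open>m x\<close> is 0 and the point is fixed; this makes \<open>r\<close>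
    both a retraction and continuous.\<close>
  define r where "r x w = x w + m x * (if w = v then real (card \<sigma>) else if w \<in> \<sigma> then -1 else 0)"
    for x w
  have m_le: "m x \<le> x w" if "w \<in> \<sigma>" for x w using that fin by (simp add: m_def)
  have m_att: "\<exists>w\<in>\<sigma>. m x = x w" for x
    using Min_in[of "x ` \<sigma>"] fin \<sigma> unfolding m_def by blast
  have m0: "m x = 0" if "x \<in> topspace ?X" "\<not> \<sigma> \<subseteq> {w. x w \<noteq> 0}" for x
    using that m_le[of _ x] m_att[of x] realization_ge_0[OF that(1)]
    by (metis (mono_tags, lifting) antisym mem_Collect_eq subsetI)
  have m_ge: "0 \<le> m x" if "x \<in> topspace ?X" for x
    using m_att[of x] realization_ge_0[OF that] by metis
  have r_id: "r x = x" if "m x = 0" for x using that by (auto simp: r_def)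
  have sub: "{w. r x w \<noteq> 0} \<subseteq> insert v {w. x w \<noteq> 0}" if x: "x \<in> topspace ?X" for x
  proof (cases "m x = 0")
    case True then show ?thesis by (auto simp: r_id)
  next
    case False
    then have "\<sigma> \<subseteq> {w. x w \<noteq> 0}" using m0 x by blast
    then show ?thesis by (auto simp: r_def split: if_splits)
  qed
  have un: "{w. x w \<noteq> 0} \<union> {w. r x w \<noteq> 0} \<in> K" if x: "x \<in> topspace ?X" for x
  proof (cases "m x = 0")
    case True then show ?thesis using realization_support[OF x] by (simp add: r_id)
  next
    case False
    then have "\<sigma> \<subseteq> {w. x w \<noteq> 0}" using m0 x by blast
    then have "insert v {w. x w \<noteq> 0} \<in> K" using ins realization_support[OF x] by blast
    then show ?thesis by (rule simplicial_complex_mono[OF K]) (use sub[OF x] in auto)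
  qed
  have rY: "r x \<in> topspace ?Y" if x: "x \<in> topspace ?X" for x
  proof (cases "m x = 0")
    case True
    then have "\<not> \<sigma> \<subseteq> {w. x w \<noteq> 0}" using m_att[of x] by auto
    then show ?thesis
      using True realization_support[OF x] x by (auto simp: r_id intro: realization_subcomplex)
  next
    case False
    let ?S = "insert v {w. x w \<noteq> 0}"
    have s: "\<sigma> \<subseteq> {w. x w \<noteq> 0}" using m0 x False by blast
    then have S: "?S \<in> K" using ins realization_support[OF x] by blast
    then have finS: "finite ?S" using K by (auto simp: simplicial_complex_def)
    have rS: "{w. r x w \<noteq> 0} \<in> K" using simplicial_complex_mono[OF K S sub[OF x]] .
    have "(\<Sum>w\<in>?S. (if w = v then real (card \<sigma>) else if w \<in> \<sigma> then -1 else 0))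
        = real (card \<sigma>) + (\<Sum>w\<in>?S - {v}. if w \<in> \<sigma> then -1 else 0)"
      using finS by (subst sum.remove[of _ v]) (auto intro!: sum.cong)
    also have "(\<Sum>w\<in>?S - {v}. if w \<in> \<sigma> then -1 else 0) = (\<Sum>w\<in>\<sigma>. - 1 :: real)"
      using finS s \<sigma>(2) by (intro sum.mono_neutral_cong_right) auto
    finally have 0: "(\<Sum>w\<in>?S. (if w = v then real (card \<sigma>) else if w \<in> \<sigma> then -1 else 0)) = 0"
      by simp
    have "sum (r x) ?S = sum x ?S"
      unfolding r_def sum.distrib sum_distrib_left[symmetric] 0 by simp
    also have "\<dots> = 1" using realization_sum[OF x _ finS] by auto
    finally have "sum (r x) ?S = 1" .
    moreover have "0 \<le> r x w" for w
      using m_ge[OF x] m_le[of w x] realization_ge_0[OF x, of w] by (auto simp: r_def)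
    ultimately have rX: "r x \<in> topspace ?X"
      using S finS rS sub[OF x] by (subst in_realization[of ?S]) auto
    obtain w where "w \<in> \<sigma>" "m x = x w" using m_att by blast
    then have "\<not> \<sigma> \<subseteq> {w. r x w \<noteq> 0}" using \<sigma>(2) by (auto simp: r_def)
    then show ?thesis using rS rX by (auto intro: realization_subcomplex)
  qed
  have cm: "continuous_map ?X euclideanreal m"
    unfolding m_def using fin \<sigma>
    by (intro continuous_map_Min continuous_map_realization_coordinate)
  then have r: "continuous_map ?X ?Y r"
    using rY continuous_map_realization_coordinate[of K] by (intro continuous_map_into_realization) (auto simp: r_def intro!: continuous_intros)
  have i: "continuous_map ?Y ?X id"
    by (rule continuous_map_realization_mono[of ?L]) auto
  have "homotopic_with (\<lambda>_. True) ?X ?X id r"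
    by (rule homotopic_straight_line[OF K _ continuous_map_realization_mono[OF _ r]]) (use un in auto)
  then have "homotopic_with (\<lambda>_. True) ?X ?X (id \<circ> r) id"
    by (simp add: homotopic_with_symD)
  moreover have "homotopic_with (\<lambda>_. True) ?Y ?Y (r \<circ> id) id"
  proof (rule homotopic_with_equal)
    show "(r \<circ> id) x = id x" if "x \<in> topspace ?Y" for x
    proof -
      have "x \<in> topspace ?X" using that by (rule realization_mono[rotated]) auto
      then have "m x = 0" using m0 realization_support[OF that] by blast
      then show ?thesis by (simp add: r_id)
    qed
    show "continuous_map ?Y ?Y (r \<circ> id)" using r i continuous_map_compose by blast
  qed auto
  ultimately show ?thesis
    unfolding homotopy_equivalent_space_def using r i by blast
qed

text \<open>A sequential acyclic matching on \<open>N\<close> with critical faces \<open>C\<close>: a toggle pairs \<open>W\<close> with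
  \<open>insert v W\<close> and passes the unpaired faces on. The bound \<open>U\<close> on the vertices only serves to
  transfer matchings along maps that are injective on \<open>U\<close>.\<close>

inductive reduces :: "'a set \<Rightarrow> 'a set set \<Rightarrow> 'a set set \<Rightarrow> bool" for U where
  base: "N \<subseteq> Pow U \<Longrightarrow> reduces U N N"
| toggle: "N \<subseteq> Pow U \<Longrightarrow> v \<in> U \<Longrightarrow> (\<And>W. W \<in> N \<Longrightarrow> insert v W \<in> N) \<Longrightarrow>
    reduces U {W\<in>N. v \<in> W \<and> W - {v} \<notin> N} C \<Longrightarrow> reduces U N C"

text \<open>The pairs \<open>W\<close>, \<open>insert v W\<close> are deleted one at a time, a
  maximal \<open>W\<close> before all others. Any face above such a \<open>W\<close> lies, up to
  \<open>v\<close>, in \<open>M\<close> and hence equals \<open>W\<close> by maximality, so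
  \<open>collapse\<close> at \<sigma> = \<open>W\<close> removes exactly this pair. The hypotheses
  survive for \<open>M - {W}\<close>.\<close>

lemma collapse_matching:
  assumes "simplicial_complex K" "finite M"
    and "\<And>W. W \<in> M \<Longrightarrow> W \<noteq> {} \<and> v \<notin> W \<and> W \<in> K \<and> insert v W \<in> K"
    and "\<And>W \<rho>. W \<in> M \<Longrightarrow> \<rho> \<in> K \<Longrightarrow> W \<subseteq> \<rho> \<Longrightarrow> v \<notin> \<rho> \<Longrightarrow> \<rho> \<in> M"
  shows "simplicial_complex {\<rho>\<in>K. \<rho> - {v} \<notin> M} \<and>
    geometric_realization K homotopy_equivalent_space geometric_realization {\<rho>\<in>K. \<rho> - {v} \<notin> M}"
  using assms
proof (induction "card M" arbitrary: M K rule: less_induct)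
  case less
  note K = less.prems(1) and M = less.prems(3) and up = less.prems(4)
  show ?case
  proof (cases "M = {}")
    case True then show ?thesis using K by (simp add: homotopy_equivalent_space_refl)
  next
    case False
    then obtain W where W: "W \<in> M" and max: "\<And>\<rho>. \<rho> \<in> M \<Longrightarrow> W \<subseteq> \<rho> \<Longrightarrow> \<rho> = W"
      using finite_has_maximal[OF less.prems(2)] by metis
    have MW: "W \<noteq> {}" "v \<notin> W" "W \<in> K" "insert v W \<in> K" using M[OF W] by auto
    let ?L = "{\<rho>\<in>K. \<not> W \<subseteq> \<rho>}"
    have star: "\<rho> = W \<or> \<rho> = insert v W" if "\<rho> \<in> K" "W \<subseteq> \<rho>" for \<rho>
    proof -
      have "\<rho> - {v} \<in> K" using simplicial_complex_mono[OF K that(1)] by blast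
      then have "\<rho> - {v} \<in> M" using up[OF W, of "\<rho> - {v}"] that(2) MW by blast
      then have "\<rho> - {v} = W" using max[of "\<rho> - {v}"] that(2) MW by blast
      then show ?thesis by blast
    qed
    have L: "simplicial_complex ?L" using K unfolding simplicial_complex_def by fastforce
    have "geometric_realization K homotopy_equivalent_space geometric_realization ?L"
    proof (rule collapse[OF K MW(1,2)])
      show "insert v \<rho> \<in> K" if "\<rho> \<in> K" "W \<subseteq> \<rho>" for \<rho>
        using star[OF that] MW by auto
    qed
    moreover have "simplicial_complex {\<rho>\<in>?L. \<rho> - {v} \<notin> M - {W}} \<and>
      geometric_realization ?L homotopy_equivalent_space
      geometric_realization {\<rho>\<in>?L. \<rho> - {v} \<notin> M - {W}}"
    proof (rule less.hyps)
      show "card (M - {W}) < card M" using W less.prems(2) by (meson card_Diff1_less)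
      show "W' \<noteq> {} \<and> v \<notin> W' \<and> W' \<in> ?L \<and> insert v W' \<in> ?L" if "W' \<in> M - {W}" for W'
        using that M[of W'] max[of W'] MW by blast
      show "\<rho> \<in> M - {W}" if "W' \<in> M - {W}" "\<rho> \<in> ?L" "W' \<subseteq> \<rho>" "v \<notin> \<rho>" for W' \<rho>
        using that up[of W' \<rho>] by blast
    qed (use L less.prems(2) in auto)
    moreover have "{\<rho>\<in>?L. \<rho> - {v} \<notin> M - {W}} = {\<rho>\<in>K. \<rho> - {v} \<notin> M}"
    proof -
      have "W \<subseteq> \<rho> \<longleftrightarrow> \<rho> - {v} = W" if "\<rho> \<in> K" for \<rho>
        using star[OF that] MW by blast
      then show ?thesis using W by blast
    qed
    ultimately show ?thesis using homotopy_eqv_trans by fastforce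
  qed
qed

text \<open>Since \<open>B\<close> is closed under subsets and disjoint from \<open>N\<close>, the
  set \<open>N\<close> is closed upwards in \<open>B \<union> N\<close>; this supplies the closure
  that \<open>collapse_matching\<close> asks for. Each toggle leaves a complex of the same shape
  over the same \<open>B\<close>. The empty face must stay outside \<open>N\<close> because it
  cannot be collapsed.\<close>

lemma reduces_homotopy:
  assumes "reduces U N C" "simplicial_complex B" "simplicial_complex (B \<union> N)" "B \<inter> N = {}" "{} \<notin> N"
  shows "simplicial_complex (B \<union> C) \<and> C \<subseteq> N \<and>
    geometric_realization (B \<union> N) homotopy_equivalent_space geometric_realization (B \<union> C)"
  using assms
proof (induction rule: reduces.induct)
  case (base N)
  then show ?case by (simp add: homotopy_equivalent_space_refl)
next
  case (toggle N v C)
  let ?K = "B \<union> N" and ?M = "{W\<in>N. v \<notin> W}" and ?N = "{W\<in>N. v \<in> W \<and> W - {v} \<notin> N}"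
  note B = \<open>simplicial_complex B\<close> and K = \<open>simplicial_complex ?K\<close>
  have up: "\<rho> \<in> N" if "W \<in> N" "\<rho> \<in> ?K" "W \<subseteq> \<rho>" for W \<rho>
    using that simplicial_complex_mono[OF B, of \<rho> W] toggle.prems(3) by blast
  have "simplicial_complex {\<rho>\<in>?K. \<rho> - {v} \<notin> ?M} \<and>
    geometric_realization ?K homotopy_equivalent_space geometric_realization {\<rho>\<in>?K. \<rho> - {v} \<notin> ?M}"
  proof (rule collapse_matching[OF K])
    show "finite ?M" using K by (auto simp: simplicial_complex_def)
    show "W \<noteq> {} \<and> v \<notin> W \<and> W \<in> ?K \<and> insert v W \<in> ?K" if "W \<in> ?M" for W
      using that toggle.hyps toggle.prems(4) by auto
    show "\<rho> \<in> ?M" if "W \<in> ?M" "\<rho> \<in> ?K" "W \<subseteq> \<rho>" "v \<notin> \<rho>" for W \<rho>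
      using that up by blast
  qed
  moreover have "{\<rho>\<in>?K. \<rho> - {v} \<notin> ?M} = B \<union> ?N"
  proof -
    have "\<rho> - {v} \<notin> N" if "\<rho> \<in> B" for \<rho>
      using simplicial_complex_mono[OF B that, of "\<rho> - {v}"] toggle.prems(3) by blast
    moreover have "v \<in> \<rho>" if "\<rho> \<in> N" "\<rho> - {v} \<notin> N" for \<rho>
      using that by (metis Diff_empty Diff_insert0)
    ultimately show ?thesis by auto
  qed
  ultimately have *: "simplicial_complex (B \<union> ?N)"
    "geometric_realization ?K homotopy_equivalent_space geometric_realization (B \<union> ?N)"
    by simp_all
  then show ?case
    using toggle.IH[OF B *(1)] toggle.prems homotopy_eqv_trans[OF *(2)] by blast
qed

section \<open>Attaching cells to a contractible complex\<close>

text \<open>A closed subset of the cube \<open>[0, 1]\<close> to the power of all vertices. The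
  condition on the support is not visibly closed, so the set is rewritten as a finite union of
  closed simplices.\<close>

lemma compact_space_realization:
  assumes K: "simplicial_complex K"
  shows "compact_space (geometric_realization K)"
proof -
  let ?S = "\<lambda>F. {x :: 'a \<Rightarrow> real. (\<forall>v. 0 \<le> x v) \<and> (\<forall>v. v \<notin> F \<longrightarrow> x v = 0) \<and> sum x F = 1}"
  let ?T = "{x :: 'a \<Rightarrow> real. (\<forall>v. 0 \<le> x v) \<and> {v. x v \<noteq> 0} \<in> K \<and> (\<Sum>v | x v \<noteq> 0. x v) = 1}"
  have eq: "?T = (\<Union>F\<in>K. ?S F)"
  proof (intro equalityI subsetI)
    fix x assume "x \<in> ?T" then show "x \<in> (\<Union>F\<in>K. ?S F)"
      by (intro UN_I[of "{v. x v \<noteq> 0}"]) auto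
  next
    fix x assume "x \<in> (\<Union>F\<in>K. ?S F)"
    then obtain F where F: "F \<in> K" "x \<in> ?S F" by blast
    then have "{v. x v \<noteq> 0} \<subseteq> F" "finite F" using K by (auto simp: simplicial_complex_def)
    then have "sum x F = (\<Sum>v | x v \<noteq> 0. x v)" by (intro sum.mono_neutral_right) auto
    then show "x \<in> ?T"
      using F simplicial_complex_mono[OF K F(1) \<open>{v. x v \<noteq> 0} \<subseteq> F\<close>] by auto
  qed
  have c: "continuous_on UNIV (\<lambda>x :: 'a \<Rightarrow> real. x v)" for v
    by (rule continuous_on_product_coordinates)
  have "closed (?S F)" for F
    by (intro closed_Collect_conj closed_Collect_all closed_Collect_imp closed_Collect_le
        closed_Collect_eq open_Collect_const continuous_intros c)
  then have "closed ?T"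
    unfolding eq using K by (intro closed_UN) (auto simp: simplicial_complex_def)
  then have "closedin (powertop_real UNIV) ?T"
    by (simp add: euclidean_product_topology)
  moreover have "compactin (powertop_real UNIV) (PiE UNIV (\<lambda>_ :: 'a. {0..1 :: real}))"
    by (simp add: compactin_PiE)
  moreover have "?T \<subseteq> PiE UNIV (\<lambda>_. {0..1 :: real})"
  proof
    fix x assume "x \<in> ?T"
    then have x: "x \<in> topspace (geometric_realization K)" by (simp add: geometric_realization_def)
    have "x v \<le> 1" for v
    proof (cases "x v = 0")
      case False
      have "finite {v. x v \<noteq> 0}" using realization_support[OF x] K by (auto simp: simplicial_complex_def)
      then have "x v \<le> (\<Sum>v | x v \<noteq> 0. x v)"
        using False realization_ge_0[OF x] by (intro member_le_sum) auto
      then show ?thesis using \<open>x \<in> ?T\<close> by simp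
    qed simp
    then show "x \<in> PiE UNIV (\<lambda>_. {0..1 :: real})" using realization_ge_0[OF x] by auto
  qed
  ultimately have "compactin (powertop_real UNIV) ?T" using closed_compactin by blast
  then show ?thesis unfolding geometric_realization_def by (rule compact_space_subtopology)
qed

text \<open>The standard argument that crushing a subspace \<open>A\<close> is a homotopy
  equivalence when \<open>A\<close> contracts inside itself along a homotopy \<open>H\<close> of the
  whole space. Here \<open>W\<close> plays the role of \<open>X / A\<close>. The end of
  \<open>H\<close> is constant on \<open>A\<close> and factors through \<open>f\<close>, giving the
  inverse \<open>g\<close>; as \<open>H\<close> preserves \<open>A\<close>, it also descends to a
  homotopy \<open>G\<close> on \<open>W\<close>.\<close>

lemma homotopy_equivalent_collapse_map:
  assumes X: "compact_space X" and W: "Hausdorff_space W"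
    and f: "continuous_map X W f" "f ` topspace X = topspace W"
    and fibre: "\<And>x y. x \<in> topspace X \<Longrightarrow> y \<in> topspace X \<Longrightarrow> f x = f y \<Longrightarrow> x = y \<or> x \<in> A \<and> y \<in> A"
    and const: "\<And>x y. x \<in> A \<Longrightarrow> y \<in> A \<Longrightarrow> f x = f y"
    and H: "continuous_map (prod_topology (top_of_set {0..1::real}) X) X H"
    and H0: "\<And>x. x \<in> topspace X \<Longrightarrow> H (0, x) = x"
    and HA: "\<And>t x. t \<in> {0..1} \<Longrightarrow> x \<in> A \<Longrightarrow> H (t, x) \<in> A"
    and H1: "\<And>x y. x \<in> A \<Longrightarrow> y \<in> A \<Longrightarrow> H (1, x) = H (1, y)"
  shows "X homotopy_equivalent_space W"
proof -
  let ?I = "top_of_set {0..1::real}"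
  have qf: "quotient_map X W f" using continuous_imp_quotient_map f X W by blast
  have H1c: "continuous_map X X (\<lambda>x. H (1, x))"
  proof -
    have "continuous_map X (prod_topology ?I X) (\<lambda>x. (1, x))"
      by (intro continuous_map_pairedI) auto
    from continuous_map_compose[OF this H] show ?thesis by (simp add: o_def)
  qed
  have H1f: "H (1, x) = H (1, y)" if "x \<in> topspace X" "y \<in> topspace X" "f x = f y" for x y
    using fibre[OF that] H1 by blast
  obtain g where g: "continuous_map W X g" "\<And>x. x \<in> topspace X \<Longrightarrow> g (f x) = H (1, x)"
    by (rule quotient_map_lift_exists[OF qf H1c]) (erule (2) H1f, rule that, assumption, simp)
  define F where "F = (\<lambda>(t::real, x). (t, f x))"
  have F: "continuous_map (prod_topology ?I X) (prod_topology ?I W) F"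
    unfolding F_def continuous_map_prod_top using f by auto
  \<comment> \<open>Descending \<open>H\<close> requires the product of \<open>f\<close> with the
    interval to be a quotient map. It is one for the same reason as \<open>f\<close>: a continuous
    surjection from a compact space onto a Hausdorff space.\<close>
  have qF: "quotient_map (prod_topology ?I X) (prod_topology ?I W) F"
  proof (rule continuous_imp_quotient_map[OF F])
    show "compact_space (prod_topology ?I X)"
      using X by (simp add: compact_space_prod_topology compact_space_subtopology)
    show "Hausdorff_space (prod_topology ?I W)"
      using W by (simp add: Hausdorff_space_prod_topology Hausdorff_space_subtopology)
    show "F ` topspace (prod_topology ?I X) = topspace (prod_topology ?I W)"
      using f(2) by (force simp: F_def)
  qed
  have fH: "continuous_map (prod_topology ?I X) W (f \<circ> H)"
    using H f(1) continuous_map_compose by blast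
  have fHF: "(f \<circ> H) a = (f \<circ> H) b"
    if ab: "a \<in> topspace (prod_topology ?I X)" "b \<in> topspace (prod_topology ?I X)" "F a = F b" for a b
  proof -
    obtain t x y where txy: "a = (t, x)" "b = (t, y)" and fxy: "f x = f y"
      using ab(3) by (cases a; cases b) (auto simp: F_def)
    then have t: "t \<in> {0..1}" and "x \<in> topspace X" "y \<in> topspace X" using ab by auto
    with fibre[OF _ _ fxy] have "x = y \<or> x \<in> A \<and> y \<in> A" by blast
    then show ?thesis using const[OF HA HA] t unfolding txy by auto
  qed
  obtain G where G: "continuous_map (prod_topology ?I W) W G"
    "\<And>z. z \<in> topspace (prod_topology ?I X) \<Longrightarrow> G (F z) = f (H z)"
    by (rule quotient_map_lift_exists[OF qF fH]) (erule (2) fHF, rule that, assumption, simp)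
  have "homotopic_with (\<lambda>_. True) X X (\<lambda>x. H (0, x)) (\<lambda>x. H (1, x))"
    unfolding homotopic_with_def using H by auto
  moreover from this have "continuous_map X X (\<lambda>x. H (0, x))"
    using homotopic_with_imp_continuous_maps by blast
  then have "homotopic_with (\<lambda>_. True) X X (\<lambda>x. H (0, x)) id"
    using H0 by (intro homotopic_with_equal) auto
  moreover have "homotopic_with (\<lambda>_. True) X X (\<lambda>x. H (1, x)) (g \<circ> f)"
    using H1c g by (intro homotopic_with_equal) auto
  ultimately have 1: "homotopic_with (\<lambda>_. True) X X (g \<circ> f) id"
    by (meson homotopic_with_symD homotopic_with_trans)
  have surj: "\<exists>x\<in>topspace X. w = f x" if "w \<in> topspace W" for w
    using that f(2) by blast
  have G0: "homotopic_with (\<lambda>_. True) W W (\<lambda>w. G (0, w)) (\<lambda>w. G (1, w))"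
    unfolding homotopic_with_def using G by auto
  then have "continuous_map W W (\<lambda>w. G (0, w))" "continuous_map W W (\<lambda>w. G (1, w))"
    using homotopic_with_imp_continuous_maps by blast+
  moreover have "G (0, w) = w" "G (1, w) = f (g w)" if w: "w \<in> topspace W" for w
  proof -
    obtain x where x: "x \<in> topspace X" "w = f x" using surj[OF w] by blast
    show "G (0, w) = w" "G (1, w) = f (g w)"
      using G(2)[of "(0, x)"] G(2)[of "(1, x)"] x H0 g(2) by (auto simp: F_def)
  qed
  ultimately have "homotopic_with (\<lambda>_. True) W W (\<lambda>w. G (0, w)) id"
    "homotopic_with (\<lambda>_. True) W W (\<lambda>w. G (1, w)) (f \<circ> g)"
    by (auto intro!: homotopic_with_equal)
  then have "homotopic_with (\<lambda>_. True) W W (f \<circ> g) id"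
    using G0 by (meson homotopic_with_symD homotopic_with_trans)
  then show ?thesis unfolding homotopy_equivalent_space_def using f g 1 by blast
qed

section \<open>Topology of wedge sums\<close>

lemma continuous_map_from_sum_topology:
  "continuous_map (sum_topology X I) Y f \<longleftrightarrow> (\<forall>i\<in>I. continuous_map (X i) Y (\<lambda>x. f (i, x)))"
  (is "?l \<longleftrightarrow> ?r")
proof
  assume ?l
  then show ?r
    by (auto simp: continuous_map_def openin_sum_topology Pi_iff)
next
  assume r: ?r
  have "openin (X i) {x. (i, x) \<in> topspace (sum_topology X I) \<and> f (i, x) \<in> U}"
    if "i \<in> I" "openin Y U" for i U
  proof -
    have "openin (X i) {x \<in> topspace (X i). f (i, x) \<in> U}"
      using r that openin_continuous_map_preimage by blast
    then show ?thesis using that by simp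
  qed
  then show ?l
    using r by (auto simp: continuous_map_def openin_sum_topology Pi_iff)
qed

text \<open>The retraction onto summand \<open>i\<close> that sends all other summands to the base
  point. Maps out of a quotient are easy to control, so these retractions stand in for a description
  of the neighbourhoods of the base point.\<close>

definition wedge_retract :: "('i \<Rightarrow> 'a) \<Rightarrow> 'i \<Rightarrow> ('i \<times> 'a) option \<Rightarrow> 'a" where
  "wedge_retract p i z = (case z of None \<Rightarrow> p i | Some (i', x) \<Rightarrow> if i' = i then x else p i)"

lemma wedge_retract_proj: "wedge_retract p i (wedge_proj p (i', x)) = (if i' = i then x else p i)"
  by (auto simp: wedge_retract_def wedge_proj_def)

lemma continuous_map_wedge_retract:
  assumes "i \<in> I" "\<And>i. i \<in> I \<Longrightarrow> p i \<in> topspace (X i)"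
  shows "continuous_map (wedge_sum X p I) (X i) (wedge_retract p i)"
proof (rule continuous_compose_quotient_map[OF quotient_map_wedge_proj])
  show "continuous_map (sum_topology X I) (X i) (wedge_retract p i \<circ> wedge_proj p)"
    unfolding continuous_map_from_sum_topology
  proof
    fix i' assume "i' \<in> I"
    show "continuous_map (X i') (X i) (\<lambda>x. (wedge_retract p i \<circ> wedge_proj p) (i', x))"
      using assms by (cases "i' = i") (simp_all add: wedge_retract_proj flip: id_def)
  qed
qed (use assms in auto)

lemma continuous_map_wedge_proj:
  assumes "i \<in> I" "\<And>i. i \<in> I \<Longrightarrow> p i \<in> topspace (X i)"
  shows "continuous_map (X i) (wedge_sum X p I) (\<lambda>x. wedge_proj p (i, x))"
proof -
  have "continuous_map (sum_topology X I) (wedge_sum X p I) (wedge_proj p)"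
    using assms by (intro quotient_imp_continuous_map quotient_map_wedge_proj) auto
  then show ?thesis using assms(1) by (simp add: continuous_map_from_sum_topology)
qed

text \<open>Two distinct points of the wedge are told apart by the retraction onto some summand, and
  disjoint neighbourhoods there pull back.\<close>

lemma Hausdorff_space_wedge_sum:
  assumes p: "\<And>i. i \<in> I \<Longrightarrow> p i \<in> topspace (X i)" and H: "\<And>i. i \<in> I \<Longrightarrow> Hausdorff_space (X i)"
  shows "Hausdorff_space (wedge_sum X p I)"
proof -
  let ?W = "wedge_sum X p I"
  have "\<exists>i\<in>I. wedge_retract p i z \<noteq> wedge_retract p i z'"
    if "z \<in> topspace ?W" "z' \<in> topspace ?W" "z \<noteq> z'" for z z'
    using that p
    by (auto simp: topspace_wedge_sum wedge_retract_def wedge_proj_def split: if_splits)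
  moreover have "\<exists>U V. openin ?W U \<and> openin ?W V \<and> z \<in> U \<and> z' \<in> V \<and> disjnt U V"
    if i: "i \<in> I" and z: "z \<in> topspace ?W" "z' \<in> topspace ?W"
      and ne: "wedge_retract p i z \<noteq> wedge_retract p i z'" for i z z'
  proof -
    let ?r = "wedge_retract p i"
    have c: "continuous_map ?W (X i) ?r" using continuous_map_wedge_retract[of i I p X] i p by blast
    then have "?r z \<in> topspace (X i)" "?r z' \<in> topspace (X i)"
      using z continuous_map_image_subset_topspace by blast+
    then obtain U V where UV: "openin (X i) U" "openin (X i) V" "?r z \<in> U" "?r z' \<in> V" "disjnt U V"
      using H[OF i] ne unfolding Hausdorff_space_def by blast
    have "openin ?W {x \<in> topspace ?W. ?r x \<in> U}" "openin ?W {x \<in> topspace ?W. ?r x \<in> V}"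
      using c UV openin_continuous_map_preimage by blast+
    moreover have "disjnt {x \<in> topspace ?W. ?r x \<in> U} {x \<in> topspace ?W. ?r x \<in> V}"
      using UV(5) by (auto simp: disjnt_def)
    ultimately show ?thesis using z UV by blast
  qed
  ultimately show ?thesis unfolding Hausdorff_space_def by metis
qed

lemma Hausdorff_space_nsphere: "Hausdorff_space (nsphere d)"
  unfolding nsphere by (intro Hausdorff_space_subtopology) (simp add: Hausdorff_space_product_topology)

text \<open>Passes from the wedge produced by attaching one cell to the plain sphere of the theorem.
  With a single summand, retraction and inclusion are inverse to each other.\<close>

lemma wedge_of_one_sphere: "wedge_of_spheres 1 d homeomorphic_space nsphere d"
  unfolding homeomorphic_space_def homeomorphic_maps_def
proof (intro exI conjI)
  show "continuous_map (wedge_of_spheres 1 d) (nsphere d) (wedge_retract (\<lambda>_. sphere_base) 0)"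
    unfolding wedge_of_spheres_def
    by (rule continuous_map_wedge_retract) (auto simp: sphere_base_in_nsphere)
  show "continuous_map (nsphere d) (wedge_of_spheres 1 d) (\<lambda>x. wedge_proj (\<lambda>_. sphere_base) (0, x))"
    unfolding wedge_of_spheres_def
    by (rule continuous_map_wedge_proj) (auto simp: sphere_base_in_nsphere)
  show "\<forall>z\<in>topspace (wedge_of_spheres 1 d).
      wedge_proj (\<lambda>_. sphere_base) (0, wedge_retract (\<lambda>_. sphere_base) 0 z) = z"
    by (auto simp: wedge_of_spheres_def topspace_wedge_sum wedge_retract_def wedge_proj_def)
qed (auto simp: wedge_retract_proj)

text \<open>With \<open>\<mu>\<close> the smallest coordinate on \<open>c\<close> and \<open>w\<close> the coordinate differences, \<open>w / \<mu>\<close> maps the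
  open cell onto Euclidean space, and \<open>g\<close> is inverse stereographic projection of \<open>w / \<mu>\<close>. The
  summand \<open>(1 - sum x c)\<^sup>2\<close> vanishes on the cell and keeps the denominators nonzero elsewhere.\<close>

lemma cell_map_exists:
  assumes K: "simplicial_complex K" and c: "c \<in> K" "card c = Suc d"
    and max: "\<And>\<rho>. \<rho> \<in> K \<Longrightarrow> c \<subseteq> \<rho> \<Longrightarrow> \<rho> = c"
  obtains g where "continuous_map (geometric_realization K) (nsphere d) g"
    and "\<And>x. x \<in> topspace (geometric_realization K) \<Longrightarrow> g x = sphere_base \<longleftrightarrow> {v. x v \<noteq> 0} \<noteq> c"
    and "inj_on g {x \<in> topspace (geometric_realization K). {v. x v \<noteq> 0} = c}"
    and "\<And>y. y \<in> topspace (nsphere d) \<Longrightarrow> y \<noteq> sphere_base \<Longrightarrow>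
          \<exists>x \<in> topspace (geometric_realization K). {v. x v \<noteq> 0} = c \<and> g x = y"
proof -
  let ?X = "geometric_realization K"
  have fin: "finite c" and ne: "c \<noteq> {}" using K c by (auto simp: simplicial_complex_def)
  obtain e where e: "bij_betw e {..d} c"
    using finite_same_card_bij[of "{..d}" c] fin c(2) by auto
  then have ec: "e i \<in> c" if "i \<le> d" for i using that by (auto simp: bij_betw_def)
  have ex_e: "\<exists>i\<le>d. v = e i" if "v \<in> c" for v using that e by (force simp: bij_betw_def)
  define \<mu> where "\<mu> x = Min (x ` c)" for x :: "'a \<Rightarrow> real"
  define w where "w x i = x (e i) - x (e 0)" for x :: "'a \<Rightarrow> real" and i
  define Q where "Q x = (\<Sum>i=1..d. (w x i)\<^sup>2) + (1 - sum x c)\<^sup>2" for x :: "'a \<Rightarrow> real"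
  \<comment> \<open>For \<open>p = w / \<mu>\<close> the inverse projection is
    \<open>(|p|^2 - 1) / (|p|^2 + 1)\<close> in coordinate 0 and \<open>2 p / (|p|^2 + 1)\<close> in
    the others. Multiplying through by the square of \<mu> keeps it defined at \<mu> = 0, where it
    yields the base point.\<close>
  define g where "g x i = (if i = 0 then (Q x - (\<mu> x)\<^sup>2) / (Q x + (\<mu> x)\<^sup>2)
      else if i \<le> d then 2 * \<mu> x * w x i / (Q x + (\<mu> x)\<^sup>2) else 0)" for x :: "'a \<Rightarrow> real" and i
  have \<mu>_le: "\<mu> x \<le> x v" if "v \<in> c" for x v using that fin by (simp add: \<mu>_def)
  have \<mu>_att: "\<exists>v\<in>c. \<mu> x = x v" for x
    using Min_in[of "x ` c"] fin ne unfolding \<mu>_def by blast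
  have \<mu>_pos: "\<mu> x \<ge> 0" if "x \<in> topspace ?X" for x
    using \<mu>_att[of x] realization_ge_0[OF that] by metis
  have \<mu>_0: "\<mu> x \<noteq> 0 \<longleftrightarrow> {v. x v \<noteq> 0} = c" if x: "x \<in> topspace ?X" for x
  proof
    assume "\<mu> x \<noteq> 0"
    then have "c \<subseteq> {v. x v \<noteq> 0}" using \<mu>_pos[OF x] \<mu>_le[of _ x] by fastforce
    then show "{v. x v \<noteq> 0} = c" using max realization_support[OF x] by blast
  next
    assume "{v. x v \<noteq> 0} = c" then show "\<mu> x \<noteq> 0" using \<mu>_att[of x] by force
  qed
  have s0: "sum x c = 1" if "x \<in> topspace ?X" "\<mu> x \<noteq> 0" for x
    using realization_sum[OF that(1) _ fin] \<mu>_0 that by blast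
  have Q0: "Q x \<ge> 0" for x unfolding Q_def by (intro add_nonneg_nonneg sum_nonneg) auto
  have P: "Q x + (\<mu> x)\<^sup>2 > 0" for x
  proof (rule ccontr)
    assume "\<not> ?thesis"
    moreover have "(\<mu> x)\<^sup>2 \<ge> 0" by simp
    ultimately have "(\<mu> x)\<^sup>2 = 0" "Q x = 0" using Q0[of x] by linarith+
    moreover have "(\<Sum>i=1..d. (w x i)\<^sup>2) \<ge> 0" "(1 - sum x c)\<^sup>2 \<ge> 0" by (auto intro: sum_nonneg)
    ultimately have 0: "\<mu> x = 0" "(\<Sum>i=1..d. (w x i)\<^sup>2) = 0" "sum x c = 1"
      unfolding Q_def by (auto simp: add_nonneg_eq_0_iff)
    then have "\<forall>i\<in>{1..d}. w x i = 0" by (subst (asm) sum_nonneg_eq_0_iff) auto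
    then have "x (e i) = x (e 0)" if "i \<le> d" for i
      using that by (cases "i = 0") (auto simp: w_def)
    then have "x v = 0" if "v \<in> c" for v using that ex_e \<mu>_att[of x] 0(1) by metis
    then show False using 0(3) by simp
  qed
  have g_base: "g x = sphere_base \<longleftrightarrow> \<mu> x = 0" for x
  proof
    assume "g x = sphere_base"
    then have "(Q x - (\<mu> x)\<^sup>2) / (Q x + (\<mu> x)\<^sup>2) = 1"
      by (auto simp: g_def sphere_base_def fun_eq_iff split: if_splits dest: spec[of _ 0])
    then show "\<mu> x = 0" using P[of x] by (simp add: field_simps)
  next
    assume "\<mu> x = 0" then show "g x = sphere_base"
      using P[of x] by (auto simp: g_def sphere_base_def)
  qed
  have split0: "(\<Sum>i\<le>d. F i) = F 0 + (\<Sum>i=1..d. F i)" for F :: "nat \<Rightarrow> real"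
    by (simp add: atMost_atLeast0 sum.atLeast_Suc_atMost)
  have g_sphere: "g x \<in> topspace (nsphere d)" if x: "x \<in> topspace ?X" for x
  proof (cases "\<mu> x = 0")
    case True then show ?thesis using g_base sphere_base_in_nsphere by metis
  next
    case False
    have Q: "Q x = (\<Sum>i=1..d. (w x i)\<^sup>2)" using s0[OF x False] by (simp add: Q_def)
    have "(\<Sum>i\<le>d. (g x i)\<^sup>2) = ((Q x - (\<mu> x)\<^sup>2) / (Q x + (\<mu> x)\<^sup>2))\<^sup>2
        + (\<Sum>i=1..d. (2 * \<mu> x / (Q x + (\<mu> x)\<^sup>2))\<^sup>2 * (w x i)\<^sup>2)"
      unfolding split0 by (auto simp: g_def power_mult_distrib power_divide intro!: sum.cong)
    also have "\<dots> = ((Q x - (\<mu> x)\<^sup>2) / (Q x + (\<mu> x)\<^sup>2))\<^sup>2 + (2 * \<mu> x / (Q x + (\<mu> x)\<^sup>2))\<^sup>2 * Q x"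
      by (simp add: Q flip: sum_distrib_left)
    also have "\<dots> = ((Q x - (\<mu> x)\<^sup>2)\<^sup>2 + 4 * (\<mu> x)\<^sup>2 * Q x) / (Q x + (\<mu> x)\<^sup>2)\<^sup>2"
      by (simp add: power_divide power_mult_distrib add_divide_distrib)
    also have "(Q x - (\<mu> x)\<^sup>2)\<^sup>2 + 4 * (\<mu> x)\<^sup>2 * Q x = (Q x + (\<mu> x)\<^sup>2)\<^sup>2"
      by (simp add: power2_eq_square algebra_simps)
    also have "\<dots> / (Q x + (\<mu> x)\<^sup>2)\<^sup>2 = 1" using P[of x] by simp
    finally show ?thesis by (auto simp: nsphere g_def)
  qed
  note crd = continuous_map_realization_coordinate[of K]
  have c\<mu>: "continuous_map ?X euclideanreal \<mu>"
    unfolding \<mu>_def using fin ne by (intro continuous_map_Min crd)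
  have cw: "continuous_map ?X euclideanreal (\<lambda>x. w x i)" for i
    unfolding w_def by (intro continuous_map_diff crd)
  have cQ: "continuous_map ?X euclideanreal Q"
    unfolding Q_def using fin by (intro continuous_intros crd cw) auto
  have P': "Q x + (\<mu> x)\<^sup>2 \<noteq> 0" for x using P[of x] by linarith
  have "continuous_map ?X euclideanreal (\<lambda>x. g x i)" for i
    unfolding g_def
    by (cases "i = 0"; cases "i \<le> d") (auto intro!: continuous_intros c\<mu> cw cQ P')
  then have cg: "continuous_map ?X (nsphere d) g"
    using g_sphere
    by (auto simp: nsphere continuous_map_in_subtopology continuous_map_componentwise_UNIV)
  have inj: "inj_on g {x \<in> topspace ?X. {v. x v \<noteq> 0} = c}"
  proof (rule inj_onI)
    fix x x' assume "x \<in> {x \<in> topspace ?X. {v. x v \<noteq> 0} = c}" "x' \<in> {x \<in> topspace ?X. {v. x v \<noteq> 0} = c}"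
      and eq: "g x = g x'"
    then have x: "x \<in> topspace ?X" "{v. x v \<noteq> 0} = c"
      and x': "x' \<in> topspace ?X" and x'c: "{v. x' v \<noteq> 0} = c" by auto
    have m: "\<mu> x > 0" "\<mu> x' > 0"
      using \<mu>_0[OF x(1)] \<mu>_0[OF x'] x(2) x'c \<mu>_pos[OF x(1)] \<mu>_pos[OF x'] by linarith+
    define R where "R x = Q x + (\<mu> x)\<^sup>2" for x
    have R: "R x > 0" "R x' > 0" using P by (auto simp: R_def)
    have "1 - 2 * ((\<mu> x)\<^sup>2 / R x) = g x 0" "1 - 2 * ((\<mu> x')\<^sup>2 / R x') = g x' 0"
      using R P' by (auto simp: g_def R_def field_simps)
    then have 1: "(\<mu> x)\<^sup>2 / R x = (\<mu> x')\<^sup>2 / R x'" using eq by simp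
    have 2: "\<mu> x * w x i / R x = \<mu> x' * w x' i / R x'" if "i \<le> d" for i
    proof (cases "i = 0")
      case False
      then have "2 * \<mu> x * w x i / R x = 2 * \<mu> x' * w x' i / R x'"
        using fun_cong[OF eq, of i] that by (auto simp: g_def R_def)
      then show ?thesis by simp
    qed (simp add: w_def)
    \<comment> \<open>Equal images mean equal quotients \<open>w / \<mu>\<close>, so all differences
      scale by \<alpha>. Then both points attain their minimum at the same vertex, hence all
      coordinates scale by \<alpha>, and the coordinate sums, both 1, force \<alpha> = 1.\<close>
    define \<alpha> where "\<alpha> = \<mu> x' / \<mu> x"
    have w: "w x' i = \<alpha> * w x i" if "i \<le> d" for i
    proof -
      have "R x' * (\<mu> x)\<^sup>2 = R x * (\<mu> x')\<^sup>2" using 1 R by (simp add: field_simps)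
      moreover have "R x' * (\<mu> x * w x i) = R x * (\<mu> x' * w x' i)"
        using 2[OF that] R by (simp add: field_simps)
      ultimately have "(R x * \<mu> x') * (\<mu> x' * w x i) = (R x * \<mu> x') * (\<mu> x * w x' i)"
        by algebra
      then have "\<mu> x' * w x i = \<mu> x * w x' i" using R m by simp
      then show ?thesis using m by (simp add: \<alpha>_def field_simps)
    qed
    obtain i0 where i0: "i0 \<le> d" "\<mu> x = x (e i0)" using \<mu>_att ex_e by metis
    have "\<alpha> > 0" using m by (simp add: \<alpha>_def)
    have i0': "\<mu> x' = x' (e i0)"
    proof -
      obtain i where i: "i \<le> d" "\<mu> x' = x' (e i)" using \<mu>_att ex_e by metis
      have "w x i0 \<le> w x i" using \<mu>_le[OF ec[OF i(1)], of x] i0 by (simp add: w_def)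
      then have "w x' i0 \<le> w x' i" using w i i0 \<open>\<alpha> > 0\<close> by simp
      then have "x' (e i0) \<le> \<mu> x'" using i by (simp add: w_def)
      then show ?thesis using \<mu>_le[OF ec[OF i0(1)], of x'] by simp
    qed
    have "x' (e i) = \<alpha> * x (e i)" if "i \<le> d" for i
    proof -
      have "x' (e i) = \<mu> x' + (w x' i - w x' i0)" by (simp add: i0' w_def)
      also have "\<dots> = \<alpha> * \<mu> x + \<alpha> * (w x i - w x i0)"
        using w that i0(1) m by (simp add: \<alpha>_def algebra_simps)
      also have "\<dots> = \<alpha> * x (e i)" by (simp add: i0 w_def algebra_simps)
      finally show ?thesis .
    qed
    then have s: "x' v = \<alpha> * x v" if "v \<in> c" for v using that ex_e by metis
    then have "sum x' c = \<alpha> * sum x c" by (simp add: sum_distrib_left)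
    then have "\<alpha> = 1" using s0[OF x(1)] s0[OF x'] m by simp
    then show "x = x'"
      using s x(2) x'c by (intro ext) (metis (mono_tags, lifting) mem_Collect_eq mult_1)
  qed
  have surj: "\<exists>x \<in> topspace ?X. {v. x v \<noteq> 0} = c \<and> g x = y"
    if y: "y \<in> topspace (nsphere d)" "y \<noteq> sphere_base" for y
  proof -
    have ys: "(\<Sum>i\<le>d. (y i)\<^sup>2) = 1" and yd: "\<And>i. i > d \<Longrightarrow> y i = 0"
      using y by (auto simp: nsphere)
    have y1: "(\<Sum>i=1..d. (y i)\<^sup>2) = 1 - (y 0)\<^sup>2" using ys unfolding split0 by simp
    have "y 0 \<noteq> 1"
    proof
      assume "y 0 = 1"
      then have "(\<Sum>i=1..d. (y i)\<^sup>2) = 0" using y1 by simp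
      then have "\<forall>i\<in>{1..d}. (y i)\<^sup>2 = 0" by (subst (asm) sum_nonneg_eq_0_iff) auto
      then have "y i = (if i = 0 then 1 else 0)" for i
        using \<open>y 0 = 1\<close> yd[of i] by (cases "i > d") auto
      then show False using y(2) by (auto simp: sphere_base_def)
    qed
    moreover have "(y 0)\<^sup>2 \<le> 1" using y1 sum_nonneg[of "{1..d}" "\<lambda>i. (y i)\<^sup>2"] by simp
    then have "y 0 \<le> 1" by (simp add: abs_square_le_1)
    ultimately have y0: "y 0 < 1" by simp
    \<comment> \<open>The preimage of \<open>y\<close>: \<open>z\<close> is its stereographic
      projection, with entry 0 at index 0 since \<open>w x 0 = 0\<close>. Shifting to minimum 1
      gives \<open>a\<close>, and normalizing by the total \<open>A\<close> gives a point with \<mu>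
      = \<open>1 / A\<close> and \<open>w / \<mu> = z\<close>.\<close>
    define z where "z i = (if i = 0 then 0 else y i / (1 - y 0))" for i
    define a where "a i = 1 - Min (z ` {..d}) + z i" for i
    define A where "A = (\<Sum>i\<le>d. a i)"
    have "Min (z ` {..d}) \<in> z ` {..d}" by (intro Min_in) auto
    then obtain i0 where i0: "i0 \<le> d" "Min (z ` {..d}) = z i0" by (metis atMost_iff imageE)
    have a1: "1 \<le> a i" if "i \<le> d" for i
    proof -
      have "Min (z ` {..d}) \<le> z i" using that by (intro Min_le) auto
      then show ?thesis unfolding a_def by linarith
    qed
    have a0: "a i0 = 1" using i0 by (simp add: a_def)
    have "A \<ge> (\<Sum>i\<le>d. 1)" unfolding A_def by (intro sum_mono) (auto simp: a1)
    then have A: "A > 0" by simp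
    define x where "x v = (if v \<in> c then a (the_inv_into {..d} e v) / A else 0)" for v
    have xe: "x (e i) = a i / A" if "i \<le> d" for i
      using that e ec by (simp add: x_def the_inv_into_f_f bij_betw_def)
    have xA: "x v \<ge> 1 / A" if v: "v \<in> c" for v
    proof -
      obtain i where "i \<le> d" "v = e i" using ex_e[OF v] by blast
      then show ?thesis using xe a1 A by (simp add: divide_right_mono)
    qed
    have xpos: "x v > 0" if "v \<in> c" for v
      using xA[OF that] A by (meson divide_pos_pos less_le_trans zero_less_one)
    have "x v \<noteq> 0 \<longleftrightarrow> v \<in> c" for v
      using xpos[of v] by (cases "v \<in> c") (auto simp: x_def)
    then have supp: "{v. x v \<noteq> 0} = c" by blast
    have "sum x c = (\<Sum>i\<le>d. x (e i))" using sum.reindex_bij_betw[OF e, of x] by simp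
    also have "\<dots> = (\<Sum>i\<le>d. a i) / A" unfolding sum_divide_distrib by (intro sum.cong) (auto simp: xe)
    also have "\<dots> = 1" using A by (simp add: A_def)
    finally have sx: "sum x c = 1" .
    have X: "x \<in> topspace ?X"
      using c fin supp xpos sx by (subst in_realization[of c]) (auto simp: x_def less_imp_le)
    have \<mu>x: "\<mu> x = 1 / A"
    proof (rule antisym)
      show "\<mu> x \<le> 1 / A" using \<mu>_le[OF ec[OF i0(1)], of x] xe[OF i0(1)] a0 by simp
      show "1 / A \<le> \<mu> x" using \<mu>_att[of x] xA by auto
    qed
    have wx: "w x i = z i / A" if "i \<le> d" for i
      using that by (simp add: w_def xe a_def z_def diff_divide_distrib[symmetric])
    have "(\<Sum>i=1..d. (w x i)\<^sup>2) = (\<Sum>i=1..d. (y i)\<^sup>2 / ((1 - y 0) * A)\<^sup>2)"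
      by (intro sum.cong) (auto simp: wx z_def power_divide power_mult_distrib)
    also have "\<dots> = (1 - (y 0)\<^sup>2) / ((1 - y 0) * A)\<^sup>2"
      by (simp only: sum_divide_distrib[symmetric] y1)
    also have "1 - (y 0)\<^sup>2 = (1 - y 0) * (1 + y 0)" by (simp add: power2_eq_square algebra_simps)
    also have "(1 - y 0) * (1 + y 0) / ((1 - y 0) * A)\<^sup>2 = (1 + y 0) / ((1 - y 0) * A\<^sup>2)"
      using y0 by (simp add: power2_eq_square)
    finally have Qx: "Q x = (1 + y 0) / ((1 - y 0) * A\<^sup>2)"
      by (simp add: Q_def sx)
    have R: "Q x + (\<mu> x)\<^sup>2 = 2 / ((1 - y 0) * A\<^sup>2)"
      using y0 A by (simp add: Qx \<mu>x power2_eq_square field_simps)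
    have "g x i = y i" for i
    proof -
      consider "i = 0" | "0 < i" "i \<le> d" | "i > d" by linarith
      then show ?thesis
      proof cases
        case 1
        have "Q x - (\<mu> x)\<^sup>2 = 2 * y 0 / ((1 - y 0) * A\<^sup>2)"
          using y0 A by (simp add: Qx \<mu>x power2_eq_square field_simps)
        then have "g x 0 = (2 * y 0 / ((1 - y 0) * A\<^sup>2)) / (2 / ((1 - y 0) * A\<^sup>2))"
          using R by (simp add: g_def)
        also have "\<dots> = y 0" using y0 A by simp
        finally show ?thesis using 1 by simp
      next
        case 2
        then have "g x i = 2 * \<mu> x * w x i / (Q x + (\<mu> x)\<^sup>2)" by (simp add: g_def)
        also have "\<dots> = 2 * (1 / A) * (y i / (1 - y 0) / A) / (2 / ((1 - y 0) * A\<^sup>2))"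
          using 2 unfolding R by (simp add: \<mu>x wx z_def)
        also have "\<dots> = y i" using y0 A by (simp add: power2_eq_square)
        finally show ?thesis .
      qed (simp add: g_def yd)
    qed
    then show ?thesis using X supp by blast
  qed
  show thesis using that[OF cg _ inj surj] g_base \<mu>_0 by blast
qed

text \<open>The map \<open>f\<close> crushes \<open>K\<close> to the base point. The homotopy \<open>H\<close> extends a contraction \<open>h\<close> of \<open>K\<close>:
  \<open>y\<close> expands each cell away from its barycentre, and the part pushed onto the boundary continues
  along \<open>h\<close>; \<open>u\<close> measures the distance of a point from \<open>K\<close>.\<close>

lemma homotopy_equivalent_wedge_of_spheres:
  assumes K: "simplicial_complex (K \<union> \<C>)" and L: "simplicial_complex K" "contractible_complex K"
    and C: "K \<inter> \<C> = {}" "finite \<C>" "\<C> \<noteq> {}" "\<And>c. c \<in> \<C> \<Longrightarrow> card c = Suc d"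
  shows "geometric_realization (K \<union> \<C>) homotopy_equivalent_space wedge_of_spheres (card \<C>) d"
proof -
  let ?M = "K \<union> \<C>"
  let ?X = "geometric_realization ?M" and ?A = "geometric_realization K"
  \<comment> \<open>All cells have the same size, so none contains another, and no face of
    \<open>K\<close> contains a cell. Hence each cell is a maximal face.\<close>
  have max: "\<rho> = c" if "c \<in> \<C>" "\<rho> \<in> ?M" "c \<subseteq> \<rho>" for c \<rho>
  proof -
    have "\<rho> \<in> \<C>" using that C(1) simplicial_complex_mono[OF L(1), of \<rho> c] by blast
    then have "card c = card \<rho>" using that C(4) by simp
    moreover have "finite \<rho>" using K that(2) by (auto simp: simplicial_complex_def)
    ultimately show ?thesis using that(3) by (metis card_subset_eq)
  qed
  have proper: "\<rho> \<in> K" if "c \<in> \<C>" "\<rho> \<subset> c" for c \<rho>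
    using max[of \<rho> c] simplicial_complex_mono[OF K, of c \<rho>] that by blast
  have finC: "finite c" and neC: "c \<noteq> {}" if "c \<in> \<C>" for c
    using that C(4)[OF that] by (auto intro: card_ge_0_finite)
  define \<mu> where "\<mu> c x = Min (x ` c)" for c and x :: "'a \<Rightarrow> real"
  have \<mu>_le: "\<mu> c x \<le> x v" if "c \<in> \<C>" "v \<in> c" for c x v using that finC by (simp add: \<mu>_def)
  have \<mu>_att: "\<exists>v\<in>c. \<mu> c x = x v" if "c \<in> \<C>" for c x
    using Min_in[of "x ` c"] finC[OF that] neC[OF that] unfolding \<mu>_def by blast
  have \<mu>_ge: "\<mu> c x \<ge> 0" if "c \<in> \<C>" "x \<in> topspace ?X" for c x
    using \<mu>_att[OF that(1), of x] realization_ge_0[OF that(2)] by metis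
  have \<mu>_0: "\<mu> c x \<noteq> 0 \<longleftrightarrow> {v. x v \<noteq> 0} = c" if c: "c \<in> \<C>" and x: "x \<in> topspace ?X" for c x
  proof
    assume "\<mu> c x \<noteq> 0"
    then have "c \<subseteq> {v. x v \<noteq> 0}" using \<mu>_ge[OF c x] \<mu>_le[OF c, of _ x] by fastforce
    then show "{v. x v \<noteq> 0} = c" using max[OF c realization_support[OF x]] by blast
  next
    assume "{v. x v \<noteq> 0} = c" then show "\<mu> c x \<noteq> 0" using \<mu>_att[OF c, of x] by force
  qed
  have c\<mu>: "continuous_map ?X euclideanreal (\<mu> c)" if "c \<in> \<C>" for c
    unfolding \<mu>_def using finC neC that by (intro continuous_map_Min continuous_map_realization_coordinate) auto
  have A_iff: "x \<in> topspace ?A \<longleftrightarrow> x \<in> topspace ?X \<and> {v. x v \<noteq> 0} \<notin> \<C>" for x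
    using C(1) realization_support[of x K] realization_support[of x ?M]
      realization_mono[of K ?M x] realization_subcomplex[of x ?M K] by blast

  have "\<forall>c\<in>\<C>. \<exists>g. continuous_map ?X (nsphere d) g \<and>
      (\<forall>x\<in>topspace ?X. g x = sphere_base \<longleftrightarrow> {v. x v \<noteq> 0} \<noteq> c) \<and>
      inj_on g {x \<in> topspace ?X. {v. x v \<noteq> 0} = c} \<and>
      (\<forall>y\<in>topspace (nsphere d). y \<noteq> sphere_base \<longrightarrow> (\<exists>x\<in>topspace ?X. {v. x v \<noteq> 0} = c \<and> g x = y))"
  proof
    fix c assume c: "c \<in> \<C>"
    obtain g where "continuous_map ?X (nsphere d) g"
      "\<And>x. x \<in> topspace ?X \<Longrightarrow> g x = sphere_base \<longleftrightarrow> {v. x v \<noteq> 0} \<noteq> c"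
      "inj_on g {x \<in> topspace ?X. {v. x v \<noteq> 0} = c}"
      "\<And>y. y \<in> topspace (nsphere d) \<Longrightarrow> y \<noteq> sphere_base \<Longrightarrow>
          \<exists>x \<in> topspace ?X. {v. x v \<noteq> 0} = c \<and> g x = y"
      by (rule cell_map_exists[OF K _ C(4)[OF c]]) (use c max[OF c] in blast)+
    then show "\<exists>g. continuous_map ?X (nsphere d) g \<and>
      (\<forall>x\<in>topspace ?X. g x = sphere_base \<longleftrightarrow> {v. x v \<noteq> 0} \<noteq> c) \<and>
      inj_on g {x \<in> topspace ?X. {v. x v \<noteq> 0} = c} \<and>
      (\<forall>y\<in>topspace (nsphere d). y \<noteq> sphere_base \<longrightarrow> (\<exists>x\<in>topspace ?X. {v. x v \<noteq> 0} = c \<and> g x = y))"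
      by (intro exI[of _ g] conjI ballI impI)
  qed
  from bchoice[OF this] obtain g where
    g_all: "\<forall>c\<in>\<C>. continuous_map ?X (nsphere d) (g c) \<and>
      (\<forall>x\<in>topspace ?X. g c x = sphere_base \<longleftrightarrow> {v. x v \<noteq> 0} \<noteq> c) \<and>
      inj_on (g c) {x \<in> topspace ?X. {v. x v \<noteq> 0} = c} \<and>
      (\<forall>y\<in>topspace (nsphere d). y \<noteq> sphere_base \<longrightarrow> (\<exists>x\<in>topspace ?X. {v. x v \<noteq> 0} = c \<and> g c x = y))"
    ..
  have g: "continuous_map ?X (nsphere d) (g c)"
    and g_base: "x \<in> topspace ?X \<Longrightarrow> g c x = sphere_base \<longleftrightarrow> {v. x v \<noteq> 0} \<noteq> c"
    and g_inj: "inj_on (g c) {x \<in> topspace ?X. {v. x v \<noteq> 0} = c}"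
    and g_surj: "y \<in> topspace (nsphere d) \<Longrightarrow> y \<noteq> sphere_base \<Longrightarrow>
        \<exists>x\<in>topspace ?X. {v. x v \<noteq> 0} = c \<and> g c x = y"
    if "c \<in> \<C>" for c x y
    using bspec[OF g_all that] by simp_all
  obtain e where e: "bij_betw e {..<card \<C>} \<C>"
    using bij_betw_from_nat_into_finite[OF C(2)] by blast
  have eC: "e i \<in> \<C>" if "i < card \<C>" for i using that e by (auto simp: bij_betw_def)
  have e_inj: "i = i'" if "e i = e i'" "i < card \<C>" "i' < card \<C>" for i i'
    using that e by (auto simp: bij_betw_def inj_on_def)
  have e_surj: "\<exists>i<card \<C>. c = e i" if "c \<in> \<C>" for c
    using that bij_betw_imp_surj_on[OF e] by (metis imageE lessThan_iff)
  have m0: "0 < card \<C>" using C(2,3) by (simp add: card_gt_0_iff)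
  let ?W = "wedge_of_spheres (card \<C>) d" and ?\<pi> = "wedge_proj (\<lambda>_ :: nat. sphere_base)"
  define f where "f x = (if {v. x v \<noteq> 0} \<in> \<C>
      then let i = the_inv_into {..<card \<C>} e {v. x v \<noteq> 0} in ?\<pi> (i, g (e i) x) else None)" for x
  have f_cell: "f x = Some (i, g (e i) x)"
    if "i < card \<C>" "x \<in> topspace ?X" "{v. x v \<noteq> 0} = e i" for i x
  proof -
    have "the_inv_into {..<card \<C>} e {v. x v \<noteq> 0} = i"
      using that e by (simp add: the_inv_into_f_f bij_betw_def)
    then show ?thesis using that eC g_base by (simp add: f_def wedge_proj_def)
  qed
  have f_A: "f x = None" if "x \<in> topspace ?A" for x
    using that unfolding A_iff f_def by simp
  have cf: "continuous_map ?X ?W f"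
  proof (rule pasting_lemma_closed)
    \<comment> \<open>The closed set \<open>?T i\<close> consists of \<open>K\<close> together with
      cell \<open>e i\<close>, cut out by the vanishing of \<mu> for all other cells. Two different
      ones overlap only in \<open>K\<close>, where both local formulas give the base point.\<close>
    let ?T = "\<lambda>i. {x \<in> topspace ?X. (\<Sum>c\<in>\<C> - {e i}. \<mu> c x) \<in> {0}}"
    have T: "\<mu> c x = 0" if "x \<in> ?T i" "c \<in> \<C>" "c \<noteq> e i" for x i c
    proof -
      have "(\<Sum>c\<in>\<C> - {e i}. \<mu> c x) = 0" using that(1) by auto
      then have "\<forall>c\<in>\<C> - {e i}. \<mu> c x = 0"
        using \<mu>_ge that(1) C(2) by (subst (asm) sum_nonneg_eq_0_iff) auto
      then show ?thesis using that by blast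
    qed
    show "finite {..<card \<C>}" by simp
    show "closedin ?X (?T i)" if "i \<in> {..<card \<C>}" for i
    proof (rule closedin_continuous_map_preimage)
      show "continuous_map ?X euclideanreal (\<lambda>x. \<Sum>c\<in>\<C> - {e i}. \<mu> c x)"
        using C(2) c\<mu> by (intro continuous_map_sum) auto
    qed simp
    show "continuous_map (subtopology ?X (?T i)) ?W (\<lambda>x. ?\<pi> (i, g (e i) x))" if "i \<in> {..<card \<C>}" for i
    proof (rule continuous_map_from_subtopology)
      have "continuous_map (nsphere d) ?W (\<lambda>y. ?\<pi> (i, y))"
        unfolding wedge_of_spheres_def using that
        by (intro continuous_map_wedge_proj) (auto simp: sphere_base_in_nsphere)
      from continuous_map_compose[OF g this]
      show "continuous_map ?X ?W (\<lambda>x. ?\<pi> (i, g (e i) x))" using that eC by (simp add: o_def)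
    qed
    show "?\<pi> (i, g (e i) x) = ?\<pi> (j, g (e j) x)"
      if ij: "i \<in> {..<card \<C>}" "j \<in> {..<card \<C>}" and x: "x \<in> topspace ?X \<inter> ?T i \<inter> ?T j" for i j x
    proof (cases "i = j")
      case False
      then have "e i \<noteq> e j" using e_inj ij by blast
      then have "\<mu> (e i) x = 0" "\<mu> (e j) x = 0" using T x ij eC by auto
      then have "g (e i) x = sphere_base" "g (e j) x = sphere_base"
        using g_base[of _ x] \<mu>_0[of _ x] x eC ij by auto
      then show ?thesis by (simp add: wedge_proj_def)
    qed simp
    show "\<exists>j. j \<in> {..<card \<C>} \<and> x \<in> ?T j \<and> f x = ?\<pi> (j, g (e j) x)" if x: "x \<in> topspace ?X" for x
    proof (cases "{v. x v \<noteq> 0} \<in> \<C>")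
      case True
      then obtain i where i: "i < card \<C>" "{v. x v \<noteq> 0} = e i" using e_surj by blast
      have "\<mu> c x = 0" if "c \<in> \<C> - {e i}" for c using \<mu>_0[of c x] that x i by blast
      then have "x \<in> ?T i" using x by simp
      moreover have "f x = ?\<pi> (i, g (e i) x)"
        using f_cell[OF i(1) x i(2)] g_base[OF eC[OF i(1)] x] i(2) by (simp add: wedge_proj_def)
      ultimately show ?thesis using i by blast
    next
      case False
      then have "\<mu> c x = 0" if "c \<in> \<C>" for c using \<mu>_0[OF that x] that by metis
      \<comment> \<open>Any index would serve for a point of \<open>K\<close>; index 0 exists
        because there is at least one cell.\<close>
      then have "x \<in> ?T 0" using x by simp
      moreover have "g (e 0) x = sphere_base" using g_base[OF eC[OF m0] x] False eC[OF m0] by metis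
      then have "f x = ?\<pi> (0, g (e 0) x)" using False by (simp add: f_def wedge_proj_def)
      ultimately show ?thesis using m0 by blast
    qed
  qed
  obtain a where a: "a \<in> topspace ?A" using L(2) unfolding contractible_complex_def by blast
  have f_surj: "f ` topspace ?X = topspace ?W"
  proof
    show "f ` topspace ?X \<subseteq> topspace ?W" using cf continuous_map_image_subset_topspace by blast
    have "None \<in> f ` topspace ?X" using f_A[OF a] a A_iff by force
    moreover have "Some (i, y) \<in> f ` topspace ?X" if "Some (i, y) \<in> topspace ?W" for i y
    proof -
      have iy: "i < card \<C>" "y \<in> topspace (nsphere d)" "y \<noteq> sphere_base"
        using that by (auto simp: wedge_of_spheres_def topspace_wedge_sum wedge_proj_def split: if_splits)
      then obtain x where "x \<in> topspace ?X" "{v. x v \<noteq> 0} = e i" "g (e i) x = y" using g_surj eC by metis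
      then show ?thesis using f_cell[OF iy(1)] by force
    qed
    ultimately show "topspace ?W \<subseteq> f ` topspace ?X" by (metis option.exhaust subsetI surj_pair)
  qed
  have fibre: "x = y \<or> x \<in> topspace ?A \<and> y \<in> topspace ?A"
    if x: "x \<in> topspace ?X" and y: "y \<in> topspace ?X" and eq: "f x = f y" for x y
  proof (cases "{v. x v \<noteq> 0} \<in> \<C>")
    case True
    then obtain i where i: "i < card \<C>" "{v. x v \<noteq> 0} = e i" using e_surj by blast
    have fx: "f x = Some (i, g (e i) x)" using f_cell[OF i(1) x i(2)] .
    then have "{v. y v \<noteq> 0} \<in> \<C>" using eq by (auto simp: f_def split: if_splits)
    then obtain j where j: "j < card \<C>" "{v. y v \<noteq> 0} = e j" using e_surj by blast
    have "i = j" "g (e i) x = g (e i) y" using f_cell[OF j(1) y j(2)] fx eq by auto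
    then show ?thesis using g_inj[OF eC[OF i(1)]] x y i j by (auto simp: inj_on_def)
  next
    case False
    then have "f x = None" by (simp add: f_def)
    then have "{v. y v \<noteq> 0} \<notin> \<C>" using f_cell[of _ y] y eq e_surj by fastforce
    then show ?thesis using False x y A_iff by blast
  qed

  define n where "n = real (Suc d)"
  have n: "n > 0" by (simp add: n_def)
  have card_n: "real (card c) = n" if "c \<in> \<C>" for c using C(4)[OF that] by (simp add: n_def)
  obtain a' h where h: "continuous_map (prod_topology (top_of_set {0..1::real}) ?A) ?A h"
    and h0: "\<And>x. h (0, x) = x" and h1: "\<And>x. h (1, x) = a'"
    using L(2) unfolding contractible_complex_def contractible_space_def homotopic_with_def id_apply by blast
  define u where "u x = (\<Sum>c\<in>\<C>. \<mu> c x)" for x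
  \<comment> \<open>At most one summand is nonzero on the realization. Each of the \<open>n\<close>
    vertices of the cell gives up at most \<open>t / (2 * n)\<close>, so at most half of the total
    weight is removed and the rescaling denominator stays at least 1/2. The cap by \<mu> stops the
    motion at the boundary.\<close>
  define y where "y z = (\<lambda>w. (snd z w - (\<Sum>c\<in>\<C>. if w \<in> c then min (\<mu> c (snd z)) (fst z / (2 * n)) else 0))
      / (1 - n * (\<Sum>c\<in>\<C>. min (\<mu> c (snd z)) (fst z / (2 * n)))))" for z :: "real \<times> ('a \<Rightarrow> real)"
  have y_eq: "y (t, x) = (\<lambda>w. (x w - (\<Sum>c\<in>\<C>. if w \<in> c then min (\<mu> c x) (t / (2 * n)) else 0))
      / (1 - n * (\<Sum>c\<in>\<C>. min (\<mu> c x) (t / (2 * n)))))" for t x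
    by (simp only: y_def fst_conv snd_conv)
  \<comment> \<open>A point arrives in \<open>K\<close> at time \<open>2 * n * u x\<close>; the time
    left over is spent along \<open>h\<close>. At the moment of arrival \<open>h\<close> is the
    identity, so the two clauses agree. On \<open>K\<close> itself \<open>u\<close> is 0 and
    \<open>H\<close> is \<open>h\<close>.\<close>
  define H where "H z = (if 2 * n * u (snd z) \<le> fst z then h (fst z - 2 * n * u (snd z), y z) else y z)" for z
  have u_cell: "u x = \<mu> c x" if "c \<in> \<C>" "x \<in> topspace ?X" "{v. x v \<noteq> 0} = c" for c x
  proof -
    have "u x = (\<Sum>c\<in>{c}. \<mu> c x)"
      unfolding u_def using C(2) that \<mu>_0 by (intro sum.mono_neutral_right) auto
    then show ?thesis by simp
  qed
  have \<mu>_A: "\<mu> c x = 0" if "c \<in> \<C>" "x \<in> topspace ?A" for c x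
    using that \<mu>_0 A_iff by blast
  have u_A: "u x = 0" if "x \<in> topspace ?A" for x
    using \<mu>_A that by (simp add: u_def)
  have y_A: "y (t, x) = x" if "x \<in> topspace ?A" "0 \<le> t" for x t
  proof -
    have "min (\<mu> c x) (t / (2 * n)) = 0" if c: "c \<in> \<C>" for c
      using \<mu>_A[OF c] that \<open>x \<in> topspace ?A\<close> \<open>0 \<le> t\<close> n by simp
    then have "(\<Sum>c\<in>\<C>. if w \<in> c then min (\<mu> c x) (t / (2 * n)) else 0) = 0"
      "(\<Sum>c\<in>\<C>. min (\<mu> c x) (t / (2 * n))) = 0" for w by (auto intro!: sum.neutral)
    then show ?thesis by (simp add: y_eq)
  qed
  define \<beta> where "\<beta> t c x = min (\<mu> c x) (t / (2 * n))" for t c x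
  have y_cell: "y (t, x) = (\<lambda>w. (x w - (if w \<in> c then \<beta> t c x else 0)) / (1 - n * \<beta> t c x))"
    and den_cell: "(\<Sum>c\<in>\<C>. min (\<mu> c x) (t / (2 * n))) = \<beta> t c x"
    if c: "c \<in> \<C>" and x: "x \<in> topspace ?X" "{v. x v \<noteq> 0} = c" and t: "0 \<le> t" for c x t
  proof -
    have 0: "min (\<mu> c' x) (t / (2 * n)) = 0" if "c' \<in> \<C> - {c}" for c'
      using \<mu>_0[of c' x] that x t n by auto
    have "(\<Sum>c\<in>\<C>. min (\<mu> c x) (t / (2 * n))) = (\<Sum>c\<in>{c}. min (\<mu> c x) (t / (2 * n)))"
      using C(2) c 0 by (intro sum.mono_neutral_right) auto
    then show 1: "(\<Sum>c\<in>\<C>. min (\<mu> c x) (t / (2 * n))) = \<beta> t c x" by (simp add: \<beta>_def)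
    have "(\<Sum>c\<in>\<C>. if w \<in> c then min (\<mu> c x) (t / (2 * n)) else 0)
        = (\<Sum>c\<in>{c}. if w \<in> c then min (\<mu> c x) (t / (2 * n)) else 0)" for w
      using C(2) c 0 by (intro sum.mono_neutral_right) auto
    then show "y (t, x) = (\<lambda>w. (x w - (if w \<in> c then \<beta> t c x else 0)) / (1 - n * \<beta> t c x))"
      using 1 unfolding y_eq \<beta>_def by simp
  qed
  have \<beta>: "n * \<beta> t c x \<le> 1 / 2" if "t \<le> 1" for t c x
  proof -
    have "n * \<beta> t c x \<le> n * (t / (2 * n))" using n by (intro mult_left_mono) (auto simp: \<beta>_def)
    also have "\<dots> \<le> 1 / 2" using n that by simp
    finally show ?thesis .
  qed
  have den: "1 - n * (\<Sum>c\<in>\<C>. min (\<mu> c x) (t / (2 * n))) \<noteq> 0"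
    if x: "x \<in> topspace ?X" and t: "0 \<le> t" "t \<le> 1" for x t
  proof (cases "{v. x v \<noteq> 0} \<in> \<C>")
    case True
    show ?thesis
      unfolding den_cell[OF True x refl t(1)] using \<beta>[OF t(2), of "{v. x v \<noteq> 0}" x] by linarith
  next
    case False
    then have "x \<in> topspace ?A" using x A_iff by blast
    then have "(\<Sum>c\<in>\<C>. min (\<mu> c x) (t / (2 * n))) = 0"
      using \<mu>_A t n by (intro sum.neutral) auto
    then show ?thesis by simp
  qed
  have yX: "y (t, x) \<in> topspace ?X" and yA: "2 * n * u x \<le> t \<Longrightarrow> y (t, x) \<in> topspace ?A"
    if x: "x \<in> topspace ?X" and t: "0 \<le> t" "t \<le> 1" for x t
  proof -
    have "y (t, x) \<in> topspace ?X \<and> (2 * n * u x \<le> t \<longrightarrow> y (t, x) \<in> topspace ?A)"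
    proof (cases "{v. x v \<noteq> 0} \<in> \<C>")
      case False
      then show ?thesis using y_A[of x t] x t A_iff by auto
    next
      case True
      then obtain c where c: "c \<in> \<C>" "{v. x v \<noteq> 0} = c" by blast
      note yc = y_cell[OF c(1) x c(2) t(1)]
      have d: "1 - n * \<beta> t c x > 0" using \<beta>[OF t(2), of c x] by linarith
      have supp: "{w. y (t, x) w \<noteq> 0} \<subseteq> c" using c(2) unfolding yc by auto
      then have M: "{w. y (t, x) w \<noteq> 0} \<in> ?M" using simplicial_complex_mono[OF K] c(1) by blast
      have "sum (y (t, x)) c = (sum x c - n * \<beta> t c x) / (1 - n * \<beta> t c x)"
        unfolding yc using card_n[OF c(1)]
        by (simp add: sum_subtractf flip: sum_divide_distrib cong: sum.cong)
      also have "sum x c = 1" using realization_sum[OF x _ finC[OF c(1)]] c(2) by simp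
      finally have "sum (y (t, x)) c = 1" using d by simp
      moreover have "0 \<le> y (t, x) w" for w
        unfolding yc using d \<mu>_le[OF c(1), of w x] realization_ge_0[OF x, of w]
        by (auto simp: \<beta>_def)
      ultimately have X: "y (t, x) \<in> topspace ?X"
        using c(1) finC supp M by (subst in_realization[of c]) auto
      moreover have "y (t, x) \<in> topspace ?A" if "2 * n * u x \<le> t"
      proof -
        have "\<mu> c x \<le> t / (2 * n)" using that n u_cell[OF c(1) x c(2)] by (simp add: field_simps)
        then have "\<beta> t c x = \<mu> c x" by (simp add: \<beta>_def)
        then obtain v where v: "v \<in> c" "\<beta> t c x = x v" using \<mu>_att[OF c(1), of x] by auto
        then have "y (t, x) v = 0" unfolding yc by simp
        then have "{w. y (t, x) w \<noteq> 0} \<subset> c" using supp v by blast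
        then show ?thesis using proper[OF c(1)] realization_subcomplex[OF X] by blast
      qed
      ultimately show ?thesis by blast
    qed
    then show "y (t, x) \<in> topspace ?X" "2 * n * u x \<le> t \<Longrightarrow> y (t, x) \<in> topspace ?A" by auto
  qed
  let ?IX = "prod_topology (top_of_set {0..1::real}) ?X"
  have cfst: "continuous_map ?IX euclideanreal fst"
    using continuous_map_fst continuous_map_into_fulltopology by blast
  have csnd: "continuous_map ?IX euclideanreal (\<lambda>z. F (snd z))"
    if "continuous_map ?X euclideanreal F" for F
    using continuous_map_compose[OF continuous_map_snd that] by (simp add: o_def)
  have cu: "continuous_map ?IX euclideanreal (\<lambda>z. 2 * n * u (snd z))"
    unfolding u_def using C(2) c\<mu> by (intro continuous_map_real_mult_left continuous_map_sum csnd) auto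
  have cy_coord: "continuous_map ?IX euclideanreal (\<lambda>z. y z w)" for w
    unfolding y_def
  proof (intro continuous_map_real_divide continuous_map_diff continuous_map_sum
      continuous_map_real_mult_left csnd[OF continuous_map_realization_coordinate] C(2))
    fix c assume c: "c \<in> \<C>"
    have *: "continuous_map ?IX euclideanreal (\<lambda>z. min (\<mu> c (snd z)) (fst z / (2 * n)))"
      using n by (intro continuous_map_real_min csnd c\<mu>[OF c] continuous_map_real_divide cfst) auto
    then show "continuous_map ?IX euclideanreal (\<lambda>z. min (\<mu> c (snd z)) (fst z / (2 * n)))" .
    show "continuous_map ?IX euclideanreal (\<lambda>z. if w \<in> c then min (\<mu> c (snd z)) (fst z / (2 * n)) else 0)"
      using * by (cases "w \<in> c") auto
  next
    fix z assume "z \<in> topspace ?IX"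
    then show "1 - n * (\<Sum>c\<in>\<C>. min (\<mu> c (snd z)) (fst z / (2 * n))) \<noteq> 0"
      using den[of "snd z" "fst z"] by (cases z) auto
  qed auto
  have cH: "continuous_map ?IX ?X H"
    unfolding H_def
  proof (rule continuous_map_cases_le[OF cu cfst])
    let ?S = "{z \<in> topspace ?IX. 2 * n * u (snd z) \<le> fst z}"
    have u0: "0 \<le> u x" if "x \<in> topspace ?X" for x
      unfolding u_def using \<mu>_ge that by (intro sum_nonneg) auto
    have p: "continuous_map (subtopology ?IX ?S) (prod_topology (top_of_set {0..1}) ?A)
        (\<lambda>z. (fst z - 2 * n * u (snd z), y z))"
    proof (rule continuous_map_pairedI)
      show "continuous_map (subtopology ?IX ?S) (top_of_set {0..1}) (\<lambda>z. fst z - 2 * n * u (snd z))"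
        unfolding continuous_map_in_subtopology
      proof
        show "continuous_map (subtopology ?IX ?S) euclideanreal (\<lambda>z. fst z - 2 * n * u (snd z))"
          by (intro continuous_map_diff continuous_map_from_subtopology cfst cu)
        show "(\<lambda>z. fst z - 2 * n * u (snd z)) \<in> topspace (subtopology ?IX ?S) \<rightarrow> {0..1}"
        proof
          fix z assume "z \<in> topspace (subtopology ?IX ?S)"
          then have "snd z \<in> topspace ?X" "fst z \<le> 1" "2 * n * u (snd z) \<le> fst z" by auto
          moreover have "0 \<le> 2 * n * u (snd z)" using u0 n calculation(1) by simp
          ultimately show "fst z - 2 * n * u (snd z) \<in> {0..1}" by simp
        qed
      qed
      show "continuous_map (subtopology ?IX ?S) ?A y"
        using yA by (intro continuous_map_into_realization continuous_map_from_subtopology cy_coord) auto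
    qed
    have "continuous_map (subtopology ?IX ?S) ?A (\<lambda>z. h (fst z - 2 * n * u (snd z), y z))"
      using continuous_map_compose[OF p h] by (simp add: o_def)
    then show "continuous_map (subtopology ?IX ?S) ?X (\<lambda>z. h (fst z - 2 * n * u (snd z), y z))"
      by (rule continuous_map_realization_mono[rotated]) blast
    show "continuous_map (subtopology ?IX {z \<in> topspace ?IX. fst z \<le> 2 * n * u (snd z)}) ?X y"
      using yX by (intro continuous_map_into_realization continuous_map_from_subtopology cy_coord) auto
    show "h (fst z - 2 * n * u (snd z), y z) = y z" if "2 * n * u (snd z) = fst z" for z
      using that h0 by simp
  qed
  show ?thesis
  proof (rule homotopy_equivalent_collapse_map[where A = "topspace ?A", OF _ _ cf f_surj fibre _ cH])
    show "compact_space ?X" using compact_space_realization[OF K] .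
    show "Hausdorff_space ?W"
      unfolding wedge_of_spheres_def
      by (intro Hausdorff_space_wedge_sum) (auto simp: sphere_base_in_nsphere Hausdorff_space_nsphere)
    show "f x = f y" if "x \<in> topspace ?A" "y \<in> topspace ?A" for x y using that f_A by simp
    show "H (0, x) = x" if x: "x \<in> topspace ?X" for x
    proof (cases "{v. x v \<noteq> 0} \<in> \<C>")
      case True
      have "\<beta> 0 {v. x v \<noteq> 0} x = 0" using \<mu>_ge[OF True x] by (simp add: \<beta>_def)
      then have "y (0, x) = x" using y_cell[OF True x refl, of 0] by (simp add: fun_eq_iff)
      moreover have "u x \<ge> 0" unfolding u_def using \<mu>_ge x by (intro sum_nonneg) auto
      then have "2 * n * u x \<le> 0 \<Longrightarrow> u x = 0" using n by (simp add: mult_le_0_iff)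
      ultimately show ?thesis using h0 by (auto simp: H_def)
    next
      case False
      then have "x \<in> topspace ?A" using x A_iff by blast
      then show ?thesis using u_A y_A[of x 0] h0 by (simp add: H_def)
    qed
    show "H (t, x) \<in> topspace ?A" if "t \<in> {0..1}" "x \<in> topspace ?A" for t x
    proof -
      have "H (t, x) = h (t, x)" using that u_A y_A by (simp add: H_def)
      moreover have "(t, x) \<in> topspace (prod_topology (top_of_set {0..1}) ?A)" using that by simp
      ultimately show ?thesis using continuous_map_image_subset_topspace[OF h] by (metis image_subset_iff)
    qed
    show "H (1, x) = H (1, y)" if "x \<in> topspace ?A" "y \<in> topspace ?A" for x y
      using that u_A y_A h1 by (simp add: H_def)
  qed
qed

section \<open>Matching the block coverings\<close>

text \<open>Toggles commute with relabelling. The map \<open>g\<close> on faces is kept apart from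
  the map \<psi> on vertices because two kinds of \<open>g\<close> occur: the image under an
  injection, and \<open>insert (L - 1)\<close> with \<psi> the identity, which drags along a vertex
  decided earlier.\<close>

lemma reduces_transfer:
  assumes "reduces U N C" "inj_on g (Pow U)"
    and "\<And>W v. W \<subseteq> U \<Longrightarrow> v \<in> U \<Longrightarrow> g (insert v W) = insert (\<psi> v) (g W)"
    and "\<And>W v. W \<subseteq> U \<Longrightarrow> v \<in> U \<Longrightarrow> \<psi> v \<in> g W \<longleftrightarrow> v \<in> W"
    and "\<And>W. W \<subseteq> U \<Longrightarrow> g W \<subseteq> U'" "\<psi> ` U \<subseteq> U'"
  shows "reduces U' (g ` N) (g ` C)"
  using assms(1)
proof induction
  case (base N)
  then show ?case using assms(5) by (intro reduces.base) blast
next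
  case (toggle N v C)
  note N = \<open>N \<subseteq> Pow U\<close> and v = \<open>v \<in> U\<close>
  have rem: "g W - {\<psi> v} = g (W - {v})" if "W \<in> N" "v \<in> W" for W
  proof -
    have W: "W - {v} \<subseteq> U" using N that by blast
    have "g W = insert (\<psi> v) (g (W - {v}))"
      using assms(3)[OF W v] that(2) by (simp add: insert_absorb)
    then show ?thesis using assms(4)[OF W v] by blast
  qed
  have mem: "g W \<in> g ` N \<longleftrightarrow> W \<in> N" if "W \<subseteq> U" for W
    using inj_on_image_mem_iff[OF assms(2) _ N] that by blast
  have "{W \<in> g ` N. \<psi> v \<in> W \<and> W - {\<psi> v} \<notin> g ` N} = g ` {W \<in> N. v \<in> W \<and> W - {v} \<notin> N}"
    (is "?A = ?B")
  proof -
    have "\<psi> v \<in> g W \<and> g W - {\<psi> v} \<notin> g ` N \<longleftrightarrow> v \<in> W \<and> W - {v} \<notin> N" if "W \<in> N" for W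
    proof -
      have "W \<subseteq> U" using that N by blast
      then show ?thesis using assms(4)[of W v] v rem[OF that] mem[of "W - {v}"] by auto
    qed
    then show ?thesis by blast
  qed
  then have "reduces U' {W \<in> g ` N. \<psi> v \<in> W \<and> W - {\<psi> v} \<notin> g ` N} (g ` C)"
    using toggle.IH by simp
  moreover have "insert (\<psi> v) W \<in> g ` N" if "W \<in> g ` N" for W
  proof -
    obtain W0 where W0: "W = g W0" "W0 \<in> N" using \<open>W \<in> g ` N\<close> by blast
    then have "insert (\<psi> v) W = g (insert v W0)" using assms(3)[of W0 v] N v by auto
    then show ?thesis using toggle.hyps(3)[OF W0(2)] by blast
  qed
  moreover have "g ` N \<subseteq> Pow U'" "\<psi> v \<in> U'" using N v assms(5,6) by blast+
  ultimately show ?case using reduces.toggle[of "g ` N" U' "\<psi> v"] by blast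
qed

text \<open>A union of blocks \<open>{p..<p + k}\<close> records which windows the vertex set meets: a window is
  missed iff its index is uncovered.\<close>

definition blocks :: "nat \<Rightarrow> nat set \<Rightarrow> nat set" where
  "blocks k W = (\<Union>p\<in>W. {p..<p + k})"

text \<open>The last \<open>c\<close> positions have to be covered although no block may start
  there.\<close>

definition block_covers :: "nat \<Rightarrow> nat \<Rightarrow> nat \<Rightarrow> nat set set" where
  "block_covers k L c = {W. W \<subseteq> {..<L} \<and> {..<L + c} \<subseteq> blocks k W}"

lemma in_blocks: "a \<in> blocks k W \<longleftrightarrow> (\<exists>p\<in>W. p \<le> a \<and> a < p + k)"
  by (auto simp: blocks_def)

section \<open>Recursion in length and overhang\<close>

lemma block_covers_1:
  assumes "c < k"
  shows "block_covers k 1 c = {{0}}"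
proof -
  have "{} \<notin> block_covers k 1 c" by (auto simp: block_covers_def blocks_def)
  moreover have "{0} \<in> block_covers k 1 c" using assms by (auto simp: block_covers_def blocks_def)
  moreover have "W = {} \<or> W = {0}" if "W \<in> block_covers k 1 c" for W
    using that by (auto simp: block_covers_def)
  ultimately show ?thesis by blast
qed

lemma block_covers_insert: "W \<in> block_covers k L c \<Longrightarrow> v < L \<Longrightarrow> insert v W \<in> block_covers k L c"
  by (auto simp: block_covers_def blocks_def)

text \<open>Position 0 forces the block at 0, which alone covers everything up to \<open>k\<close>.
  The top block is therefore always dispensable.\<close>

lemma block_covers_residue_empty:
  assumes "1 < L" "L + c \<le> k"
  shows "{W \<in> block_covers k L c. L - 1 \<in> W \<and> W - {L - 1} \<notin> block_covers k L c} = {}"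
proof -
  have "W - {L - 1} \<in> block_covers k L c" if "W \<in> block_covers k L c" for W
  proof -
    have "0 \<in> blocks k W" using that assms by (auto simp: block_covers_def)
    then have "0 \<in> W - {L - 1}" using assms by (auto simp: in_blocks)
    then have "{..<L + c} \<subseteq> blocks k (W - {L - 1})" using assms by (auto simp: in_blocks intro!: bexI[of _ 0])
    then show ?thesis using that by (auto simp: block_covers_def)
  qed
  then show ?thesis by blast
qed

text \<open>The top block covers all of \<open>{L - 1..<L + c}\<close>, as \<open>c < k\<close>. It
  is indispensable exactly when no other block reaches \<open>L + c - 1\<close>, that is, when all
  others start below \<open>L + c - k\<close>. These must cover \<open>{..<L - 1}\<close> by
  themselves, and \<open>L - 1\<close> is the new length plus the new overhang.\<close>

lemma block_covers_residue:
  assumes "1 < L" "k < L + c" "c < k"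
  shows "{W \<in> block_covers k L c. L - 1 \<in> W \<and> W - {L - 1} \<notin> block_covers k L c} =
    insert (L - 1) ` block_covers k (L + c - k) (k - 1 - c)" (is "?A = ?B")
proof (intro equalityI subsetI)
  fix W assume "W \<in> ?A"
  then have W: "W \<subseteq> {..<L}" "{..<L + c} \<subseteq> blocks k W" "L - 1 \<in> W"
    and "\<not> {..<L + c} \<subseteq> blocks k (W - {L - 1})" by (auto simp: block_covers_def)
  then obtain a where a: "a < L + c" "a \<notin> blocks k (W - {L - 1})" by blast
  have low: "b \<in> blocks k (W - {L - 1})" if b: "b < L - 1" for b
  proof -
    have "b \<in> blocks k W" using W(2) b by auto
    then show ?thesis using b by (auto simp: in_blocks)
  qed
  then have "L - 1 \<le> a" using a(2) by (meson not_le)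
  have "p < L + c - k" if "p \<in> W - {L - 1}" for p
  proof -
    have "p < L - 1" using that W(1) by fastforce
    moreover have "\<not> (p \<le> a \<and> a < p + k)" using a(2) that unfolding in_blocks by blast
    ultimately have "p + k \<le> a" using \<open>L - 1 \<le> a\<close> by linarith
    then show ?thesis using a(1) by linarith
  qed
  moreover have "L + c - k + (k - 1 - c) = L - 1" using assms by linarith
  ultimately have "W - {L - 1} \<in> block_covers k (L + c - k) (k - 1 - c)"
    using low by (auto simp: block_covers_def)
  moreover have "W = insert (L - 1) (W - {L - 1})" using W(3) by blast
  ultimately show "W \<in> ?B" by blast
next
  fix W assume "W \<in> ?B"
  then obtain W' where W': "W = insert (L - 1) W'" "W' \<subseteq> {..<L + c - k}" "{..<L - 1} \<subseteq> blocks k W'"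
    using assms by (auto simp: block_covers_def)
  have nin: "L - 1 \<notin> W'" using W'(2) assms by auto
  have "W \<subseteq> {..<L}" using W'(1,2) assms by fastforce
  moreover have "a \<in> blocks k W" if "a < L + c" for a
  proof (cases "a < L - 1")
    case True
    then have "a \<in> blocks k W'" using W'(3) by auto
    then show ?thesis using W'(1) by (auto simp: in_blocks)
  next
    case False then show ?thesis using that assms W'(1) by (auto simp: in_blocks)
  qed
  moreover have "\<not> {..<L + c} \<subseteq> blocks k W'"
  proof -
    have "L + c - 1 \<notin> blocks k W'" using W'(2) assms by (fastforce simp: in_blocks)
    moreover have "L + c - 1 < L + c" using assms by linarith
    ultimately show ?thesis by blast
  qed
  ultimately show "W \<in> ?A" using nin W'(1) by (auto simp: block_covers_def)
qed

lemma reduces_block_covers_empty: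
  assumes "1 < L" "L + c \<le> k"
  shows "reduces {..<L} (block_covers k L c) {}"
proof (rule reduces.toggle[of _ _ "L - 1"])
  show "reduces {..<L} {W \<in> block_covers k L c. L - 1 \<in> W \<and> W - {L - 1} \<notin> block_covers k L c} {}"
    unfolding block_covers_residue_empty[OF assms] by (rule reduces.base) simp
qed (use assms block_covers_insert in \<open>auto simp: block_covers_def\<close>)

lemma reduces_block_covers_step:
  assumes "1 < L" "k < L + c" "c < k"
    and "reduces {..<L + c - k} (block_covers k (L + c - k) (k - 1 - c)) C"
  shows "reduces {..<L} (block_covers k L c) (insert (L - 1) ` C)"
proof (rule reduces.toggle[of _ _ "L - 1"])
  have "reduces {..<L} (insert (L - 1) ` block_covers k (L + c - k) (k - 1 - c)) (insert (L - 1) ` C)"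
  proof (rule reduces_transfer[OF assms(4), where \<psi> = id])
    show "inj_on (insert (L - 1)) (Pow {..<L + c - k})"
    proof (rule inj_onI)
      fix A B assume "A \<in> Pow {..<L + c - k}" "B \<in> Pow {..<L + c - k}" "insert (L - 1) A = insert (L - 1) B"
      moreover from this have "L - 1 \<notin> A" "L - 1 \<notin> B" using assms by auto
      ultimately show "A = B" by (metis insert_ident)
    qed
  qed (use assms in fastforce)+
  then show "reduces {..<L} {W \<in> block_covers k L c. L - 1 \<in> W \<and> W - {L - 1} \<notin> block_covers k L c}
      (insert (L - 1) ` C)"
    unfolding block_covers_residue[OF assms(1-3)] .
qed (use assms block_covers_insert in \<open>auto simp: block_covers_def\<close>)

text \<open>The problem in between has length \<open>L + c + 1\<close> and overhang
  \<open>k - 1 - c\<close>; its top position \<open>L + c\<close> and the outer top position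
  \<open>L + k\<close> are the two added vertices.\<close>

lemma reduces_block_covers_two_steps:
  assumes "0 < L" "c < k" and "reduces {..<L} (block_covers k L c) C"
  shows "reduces {..<L + k + 1} (block_covers k (L + k + 1) c) ((\<lambda>W. insert (L + k) (insert (L + c) W)) ` C)"
proof -
  have "reduces {..<L + c + 1} (block_covers k (L + c + 1) (k - 1 - c)) (insert (L + c) ` C)"
  proof -
    have "L + c + 1 + (k - 1 - c) - k = L" "k - 1 - (k - 1 - c) = c" using assms by linarith+
    then show ?thesis
      using reduces_block_covers_step[of "L + c + 1" k "k - 1 - c" C] assms by simp
  qed
  moreover have "L + k + 1 + c - k = L + c + 1" by linarith
  ultimately have "reduces {..<L + k + 1} (block_covers k (L + k + 1) c) (insert (L + k + 1 - 1) ` insert (L + c) ` C)"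
    using assms by (intro reduces_block_covers_step) simp_all
  then show ?thesis by (simp add: image_image)
qed

text \<open>The last clause asks for a gap at a position at least \<open>c\<close>, not just
  anywhere. For \<open>c = k - 1 - s\<close> such a position \<open>a\<close> belongs to the window
  \<open>s + 1 + a\<close>, whose index is at least \<open>k\<close>; this is how boundaries of
  critical faces get into the last complex.\<close>

lemma reduces_block_covers_odd:
  assumes "c < k"
  shows "\<exists>C. reduces {..<q * (k + 1) + 1} (block_covers k (q * (k + 1) + 1) c) {C} \<and>
    C \<subseteq> {..<q * (k + 1) + 1} \<and> card C = 2 * q + 1 \<and>
    (\<forall>x\<in>C. \<not> {c..<q * (k + 1) + 1 + c} \<subseteq> blocks k (C - {x}))"
proof (induction q)
  case 0
  have "reduces {..<1} (block_covers k 1 c) {{0}}"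
    unfolding block_covers_1[OF assms] by (rule reduces.base) simp
  then show ?case by (intro exI[of _ "{0}"]) (auto simp: blocks_def)
next
  case (Suc q)
  define L where "L = q * (k + 1) + 1"
  have L: "Suc q * (k + 1) + 1 = L + k + 1" "0 < L" by (simp_all add: L_def)
  obtain C where C: "reduces {..<L} (block_covers k L c) {C}" "C \<subseteq> {..<L}" "card C = 2 * q + 1"
    "\<And>x. x \<in> C \<Longrightarrow> \<not> {c..<L + c} \<subseteq> blocks k (C - {x})"
    using Suc.IH unfolding L_def by blast
  let ?C = "insert (L + k) (insert (L + c) C)"
  have "reduces {..<L + k + 1} (block_covers k (L + k + 1) c) {?C}"
    using reduces_block_covers_two_steps[OF L(2) assms C(1)] by simp
  moreover have "?C \<subseteq> {..<L + k + 1}" using C(2) assms by auto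
  moreover have "card ?C = 2 * Suc q + 1"
  proof -
    have "finite C" using C(2) finite_subset by blast
    moreover have "L + c \<notin> C" "L + k \<notin> insert (L + c) C" using C(2) assms by auto
    ultimately show ?thesis using C(3) by simp
  qed
  moreover have "\<not> {c..<L + k + 1 + c} \<subseteq> blocks k (?C - {x})" if x: "x \<in> ?C" for x
  proof -
    \<comment> \<open>Without an old vertex, its old gap below \<open>L + c\<close> stays open,
      since both new blocks start at \<open>L + c\<close> or later. Without \<open>L + k\<close>,
      the block at \<open>L + c\<close> ends just before \<open>L + k + c\<close>. Without
      \<open>L + c\<close>, the old blocks end before \<open>L + k - 1\<close> and the top block
      starts after it.\<close>
    consider "x \<in> C" | "x = L + k" | "x = L + c" using x by blast
    then have "\<exists>a\<in>{c..<L + k + 1 + c}. a \<notin> blocks k (?C - {x})"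
    proof cases
      case 1
      then obtain a where a: "c \<le> a" "a < L + c" "a \<notin> blocks k (C - {x})" using C(4)[of x] by force
      then have "a \<notin> blocks k (?C - {x})" using assms by (auto simp: in_blocks)
      then show ?thesis using a by (intro bexI[of _ a]) auto
    next
      case 2
      then have "L + k + c \<notin> blocks k (?C - {x})" using C(2) by (fastforce simp: in_blocks)
      then show ?thesis by (intro bexI[of _ "L + k + c"]) auto
    next
      case 3
      then have "L + k - 1 \<notin> blocks k (?C - {x})" using C(2) L(2) by (fastforce simp: in_blocks)
      then show ?thesis using assms L(2) by (intro bexI[of _ "L + k - 1"]) auto
    qed
    then show ?thesis by blast
  qed
  ultimately show ?case unfolding L(1) by blast
qed

text \<open>One round with overhang \<open>c\<close> leads to the previous lemma with the
  complementary overhang \<open>k - 1 - c\<close>, at the price of one more vertex. In the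
  application \<open>k - c\<close> is the residue \<open>t\<close>.\<close>

lemma reduces_block_covers_even:
  assumes "c < k"
  shows "\<exists>C. reduces {..<q * (k + 1) + (k - c) + 1} (block_covers k (q * (k + 1) + (k - c) + 1) c) {C} \<and>
    C \<subseteq> {..<q * (k + 1) + (k - c) + 1} \<and> card C = 2 * q + 2"
proof -
  let ?L1 = "q * (k + 1) + 1" and ?L = "q * (k + 1) + (k - c) + 1"
  have "k - 1 - c < k" using assms by linarith
  then obtain C where C: "reduces {..<?L1} (block_covers k ?L1 (k - 1 - c)) {C}" "C \<subseteq> {..<?L1}" "card C = 2 * q + 1"
    using reduces_block_covers_odd by metis
  have "?L + c - k = ?L1" using assms by linarith
  then have "reduces {..<?L} (block_covers k ?L c) (insert (?L - 1) ` {C})"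
    using assms C(1) by (intro reduces_block_covers_step) (simp_all del: mult_Suc_right)
  moreover have "finite C" using C(2) finite_subset by blast
  then have "card (insert (?L - 1) C) = 2 * q + 2" using C(2,3) assms by (subst card_insert_disjoint) force+
  moreover have "insert (?L - 1) C \<subseteq> {..<?L}" using C(2) by force
  ultimately show ?thesis by (intro exI[of _ "insert (?L - 1) C"]) (simp del: mult_Suc_right)
qed

text \<open>Peeling off double rounds leaves length \<open>t + 1\<close>. Either one block suffices
  there, or one more round gives length \<open>t + 1 + c - k\<close>, at least 2 because
  \<open>t \<noteq> k - c\<close>, with \<open>t\<close> positions to cover; as
  \<open>t \<le> k\<close>, one block again suffices.\<close>

lemma reduces_block_covers_none:
  assumes "c < k" "0 < t" "t \<le> k" "t \<noteq> k - c"
  shows "reduces {..<q * (k + 1) + t + 1} (block_covers k (q * (k + 1) + t + 1) c) {}"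
proof (induction q)
  case 0
  show ?case
  proof (cases "t + 1 + c \<le> k")
    case True
    then show ?thesis using reduces_block_covers_empty[of "t + 1" c k] assms by simp
  next
    case False
    define L where "L = t + 1 + c - k"
    have "1 < L" "L + (k - 1 - c) \<le> k" using False assms by (auto simp: L_def)
    then have "reduces {..<L} (block_covers k L (k - 1 - c)) {}" by (rule reduces_block_covers_empty)
    then show ?thesis
      using reduces_block_covers_step[of "t + 1" k c "{}"] False assms by (simp add: L_def)
  qed
next
  case (Suc q)
  have eq: "Suc q * (k + 1) + t + 1 = (q * (k + 1) + t + 1) + k + 1" by simp
  show ?case
    using reduces_block_covers_two_steps[OF _ assms(1) Suc.IH] unfolding eq image_empty by simp
qed

section \<open>Windows of the tight cycle\<close>

lemma mod_eq_imp_eq: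
  fixes x y n :: nat
  assumes "x mod n = y mod n" "x < y + n" "y < x + n"
  shows "x = y"
proof -
  have *: "a = b" if "a \<le> b" "a mod n = b mod n" "b < a + n" for a b :: nat
  proof -
    have "n dvd b - a" using that by (metis mod_eq_dvd_iff_nat)
    then have "b - a = 0" using that(3) by (metis add.commute dvd_imp_le less_diff_conv2 not_le that(1) neq0_conv)
    then show ?thesis using that(1) by simp
  qed
  show ?thesis using *[of x y] *[of y x] assms by (cases "x \<le> y") auto
qed

lemma in_tight_edge: "v \<in> tight_edge n k s \<longleftrightarrow> (\<exists>i<k. v = (s + i) mod n)"
  by (auto simp: tight_edge_def)

text \<open>Turns the deletion of edges, a set difference, into a restriction of the start indices.
  If an edge had two starts, the predecessor of one of them would also lie in the edge, which
  \<open>k < n\<close> excludes.\<close>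

lemma inj_on_tight_edge:
  assumes "0 < k" "k < n"
  shows "inj_on (tight_edge n k) {..<n}"
proof (rule inj_onI)
  fix s s' assume s: "s \<in> {..<n}" "s' \<in> {..<n}" and eq: "tight_edge n k s = tight_edge n k s'"
  have "s mod n \<in> tight_edge n k s" using assms by (auto simp: in_tight_edge)
  then obtain i where i: "i < k" "s mod n = (s' + i) mod n" unfolding eq in_tight_edge by blast
  have "i = 0"
  proof (rule ccontr)
    assume "i \<noteq> 0"
    have "i - 1 < k" using i(1) by linarith
    then have "(s' + (i - 1)) mod n \<in> tight_edge n k s" unfolding eq in_tight_edge by blast
    then obtain i' where i': "i' < k" "(s' + (i - 1)) mod n = (s + i') mod n" unfolding in_tight_edge by blast
    have "s' + i = (s' + (i - 1)) + 1" using \<open>i \<noteq> 0\<close> by simp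
    then have "(s' + i) mod n = ((s' + (i - 1)) mod n + 1) mod n" by (simp only: mod_add_left_eq)
    also have "\<dots> = (s + (i' + 1)) mod n" unfolding i'(2) mod_add_left_eq by simp
    finally have "(s' + i) mod n = (s + (i' + 1)) mod n" .
    then have "s mod n = (s + (i' + 1)) mod n" using i(2) by simp
    then have "s = s + (i' + 1)" by (rule mod_eq_imp_eq) (use i'(1) assms in auto)
    then show False by simp
  qed
  then show "s = s'" using i(2) s by simp
qed

definition window_noncovers :: "nat \<Rightarrow> nat \<Rightarrow> nat \<Rightarrow> nat set set" where
  "window_noncovers n k s = noncover_complex {..<n} (tight_edge n k ` {s..<n})"

lemma noncover_tight_cycle_del:
  assumes "0 < k" "k < n" "j \<le> n"
  shows "noncover_complex {..<n} (tight_cycle_del n k j) = window_noncovers n k j"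
proof -
  have "tight_cycle_del n k j = tight_edge n k ` ({..<n} - {..<j})"
    unfolding tight_cycle_del_def tight_cycle_def
    using assms(3) by (intro inj_on_image_set_diff[OF inj_on_tight_edge[OF assms(1,2)], symmetric]) auto
  also have "{..<n} - {..<j} = {j..<n}" by auto
  finally show ?thesis by (simp add: window_noncovers_def)
qed

lemma in_window_noncovers:
  "W \<in> window_noncovers n k s \<longleftrightarrow> W \<subseteq> {..<n} \<and> (\<exists>i\<in>{s..<n}. W \<inter> tight_edge n k i = {})"
  by (auto simp: window_noncovers_def noncover_complex_def is_cover_def)

lemma simplicial_complex_window_noncovers: "simplicial_complex (window_noncovers n k s)"
proof -
  have "window_noncovers n k s \<subseteq> Pow {..<n}" by (auto simp: in_window_noncovers)
  moreover have "finite (Pow {..<n})" by simp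
  ultimately have fin: "finite (window_noncovers n k s)" by (rule finite_subset)
  show ?thesis
    unfolding simplicial_complex_def
  proof (intro conjI ballI allI impI)
    fix \<sigma> assume \<sigma>: "\<sigma> \<in> window_noncovers n k s"
    then show "finite \<sigma>" using finite_subset[OF _ finite_lessThan] by (auto simp: in_window_noncovers)
    show "\<tau> \<in> window_noncovers n k s" if "\<tau> \<subseteq> \<sigma>" for \<tau>
      using \<sigma> that unfolding in_window_noncovers by blast
  qed (rule fin)
qed

lemma window_noncovers_mono: "s \<le> s' \<Longrightarrow> window_noncovers n k s' \<subseteq> window_noncovers n k s"
  by (force simp: in_window_noncovers)

lemma empty_in_window_noncovers: "s < n \<Longrightarrow> {} \<in> window_noncovers n k s"
  by (auto simp: in_window_noncovers)

text \<open>For \<open>s \<ge> k\<close> the vertex \<open>k - 1\<close> lies in none of the remaining windows.\<close>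

lemma contractible_window_noncovers:
  assumes "0 < k" "k \<le> s" "s < n"
  shows "contractible_complex (window_noncovers n k s)"
proof (rule contractible_cone[OF simplicial_complex_window_noncovers, where v = "k - 1"])
  show "window_noncovers n k s \<noteq> {}" using empty_in_window_noncovers assms by blast
  fix W assume "W \<in> window_noncovers n k s"
  then obtain i where W: "W \<subseteq> {..<n}" and i: "s \<le> i" "i < n" "W \<inter> tight_edge n k i = {}"
    by (auto simp: in_window_noncovers)
  have "k - 1 \<notin> tight_edge n k i"
  proof
    assume "k - 1 \<in> tight_edge n k i"
    then obtain a where a: "a < k" "k - 1 = (i + a) mod n" unfolding in_tight_edge by blast
    \<comment> \<open>As \<open>i \<ge> k\<close>, vertex \<open>k - 1\<close> can be reached only
      after passing 0, hence the representative \<open>k - 1 + n\<close>. It is out of reach for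
      every start \<open>i < n\<close>.\<close>
    then have "(k - 1 + n) mod n = (i + a) mod n" using assms by simp
    then have "k - 1 + n = i + a" by (rule mod_eq_imp_eq) (use a(1) i assms in linarith)+
    then show False using a(1) i(2) by linarith
  qed
  then show "insert (k - 1) W \<in> window_noncovers n k s"
    using W i assms by (auto simp: in_window_noncovers)
qed

section \<open>Faces between consecutive stages as block coverings\<close>

definition shifted :: "nat \<Rightarrow> nat \<Rightarrow> nat \<Rightarrow> nat \<Rightarrow> nat" where
  "shifted n k s p = (s + k + p) mod n"

lemma inj_on_shifted: "inj_on (shifted n k s) {..<n}"
proof (rule inj_onI)
  fix p p' assume "p \<in> {..<n}" "p' \<in> {..<n}" "shifted n k s p = shifted n k s p'"
  then have "s + k + p = s + k + p'"
    unfolding shifted_def by (intro mod_eq_imp_eq[of "s + k + p" n "s + k + p'"]) auto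
  then show "p = p'" by simp
qed

lemma image_shifted:
  assumes "k < n"
  shows "shifted n k s ` {..<n - k} = {..<n} - tight_edge n k s"
proof -
  have inj: "inj_on (\<lambda>i. (s + i) mod n) {..<n}"
    using inj_on_shifted[of n 0 s] by (simp add: shifted_def[abs_def])
  have "(\<lambda>i. (s + i) mod n) ` {..<n} \<subseteq> {..<n}" using assms by auto
  then have onto: "(\<lambda>i. (s + i) mod n) ` {..<n} = {..<n}"
    using inj by (meson endo_inj_surj finite_lessThan)
  have "shifted n k s ` {..<n - k} = (\<lambda>i. (s + i) mod n) ` ((+) k ` {..<n - k})"
    unfolding image_image shifted_def by (simp add: add.assoc)
  also have "(+) k ` {..<n - k} = {..<n} - {..<k}"
  proof (intro equalityI subsetI)
    fix x assume "x \<in> {..<n} - {..<k}"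
    then have "x = k + (x - k)" "x - k \<in> {..<n - k}" by auto
    then show "x \<in> (+) k ` {..<n - k}" by blast
  qed auto
  also have "(\<lambda>i. (s + i) mod n) ` ({..<n} - {..<k}) = {..<n} - tight_edge n k s"
    using assms by (subst inj_on_image_set_diff[OF inj]) (auto simp: onto tight_edge_def)
  finally show ?thesis .
qed

text \<open>Position \<open>p\<close> lies in window \<open>s + 1 + a\<close> when
  \<open>k + p = 1 + a + i\<close> for some \<open>i < k\<close>, which says that the block of
  \<open>p\<close> contains \<open>a\<close>. The bounds on \<open>p\<close> and \<open>a\<close>
  keep the two representatives less than \<open>n\<close> apart, so no wrapping interferes.\<close>

lemma shifted_meets_edge:
  assumes "s < k" "k < n" "W \<subseteq> {..<n - k}" "a < n - 1 - s"
  shows "shifted n k s ` W \<inter> tight_edge n k (s + 1 + a) \<noteq> {} \<longleftrightarrow> a \<in> blocks k W"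
proof -
  have "shifted n k s p \<in> tight_edge n k (s + 1 + a) \<longleftrightarrow> p \<le> a \<and> a < p + k" if p: "p \<in> W" for p
  proof
    have pn: "p < n - k" using p assms(3) by auto
    assume "shifted n k s p \<in> tight_edge n k (s + 1 + a)"
    then obtain i where i: "i < k" "(s + k + p) mod n = (s + 1 + a + i) mod n"
      unfolding in_tight_edge shifted_def by blast
    have "s + k + p = s + 1 + a + i"
      by (rule mod_eq_imp_eq[OF i(2)]) (use i(1) pn assms in linarith)+
    then show "p \<le> a \<and> a < p + k" using i(1) by linarith
  next
    assume a: "p \<le> a \<and> a < p + k"
    then have "s + k + p = s + 1 + a + (k + p - 1 - a)" "k + p - 1 - a < k" by linarith+
    then show "shifted n k s p \<in> tight_edge n k (s + 1 + a)"
      unfolding in_tight_edge shifted_def by metis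
  qed
  then show ?thesis unfolding in_blocks by blast
qed

text \<open>Such a face misses window \<open>s\<close> and meets all \<open>n - 1 - s\<close> later
  ones. With \<open>n - k\<close> free positions this leaves the overhang
  \<open>n - 1 - s - (n - k) = k - 1 - s\<close>.\<close>

lemma window_noncovers_diff:
  assumes "s < k" "k < n"
  shows "window_noncovers n k s - window_noncovers n k (s + 1) =
    (`) (shifted n k s) ` block_covers k (n - k) (k - 1 - s)"
proof -
  have char: "W \<in> window_noncovers n k s - window_noncovers n k (s + 1) \<longleftrightarrow>
      W \<subseteq> {..<n} - tight_edge n k s \<and> (\<forall>a<n - 1 - s. W \<inter> tight_edge n k (s + 1 + a) \<noteq> {})" (is "?l \<longleftrightarrow> ?r") for W
  proof -
    have "{s..<n} = insert s {s + 1..<n}" using assms by auto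
    moreover have "i \<in> {s + 1..<n} \<longleftrightarrow> (\<exists>a<n - 1 - s. i = s + 1 + a)" for i
      by (auto intro!: exI[of _ "i - (s + 1)"])
    ultimately have "?l \<longleftrightarrow> W \<subseteq> {..<n} \<and> W \<inter> tight_edge n k s = {} \<and>
        (\<forall>i\<in>{s + 1..<n}. W \<inter> tight_edge n k i \<noteq> {})"
      "(\<forall>i\<in>{s + 1..<n}. W \<inter> tight_edge n k i \<noteq> {}) \<longleftrightarrow> (\<forall>a<n - 1 - s. W \<inter> tight_edge n k (s + 1 + a) \<noteq> {})"
      by (auto simp: in_window_noncovers)
    then show ?thesis by blast
  qed
  have bound: "n - k + (k - 1 - s) = n - 1 - s" using assms by linarith
  have eqv: "shifted n k s ` W \<in> window_noncovers n k s - window_noncovers n k (s + 1) \<longleftrightarrow>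
      W \<in> block_covers k (n - k) (k - 1 - s)" if "W \<subseteq> {..<n - k}" for W
  proof -
    have "shifted n k s ` W \<subseteq> {..<n} - tight_edge n k s"
      using image_mono[OF that, of "shifted n k s"] image_shifted[OF assms(2), of s] by simp
    moreover have "W \<in> block_covers k (n - k) (k - 1 - s) \<longleftrightarrow> (\<forall>a<n - 1 - s. a \<in> blocks k W)"
      unfolding block_covers_def bound using that by auto
    ultimately show ?thesis
      unfolding char using shifted_meets_edge[OF assms that] by blast
  qed
  show ?thesis
  proof (intro equalityI subsetI)
    fix W assume W: "W \<in> window_noncovers n k s - window_noncovers n k (s + 1)"
    then have "W \<subseteq> shifted n k s ` {..<n - k}" unfolding char image_shifted[OF assms(2)] by blast
    then obtain W' where "W' \<subseteq> {..<n - k}" "W = shifted n k s ` W'" by (auto simp: subset_image_iff)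
    then show "W \<in> (`) (shifted n k s) ` block_covers k (n - k) (k - 1 - s)" using W eqv by blast
  next
    fix W assume "W \<in> (`) (shifted n k s) ` block_covers k (n - k) (k - 1 - s)"
    then obtain W' where "W = shifted n k s ` W'" "W' \<in> block_covers k (n - k) (k - 1 - s)" by blast
    then show "W \<in> window_noncovers n k s - window_noncovers n k (s + 1)"
      using eqv[of W'] by (auto simp: block_covers_def)
  qed
qed

lemma reduces_window_noncovers:
  assumes "s < k" "k < n"
    and "reduces {..<n - k} (block_covers k (n - k) (k - 1 - s)) C"
  shows "reduces {..<n} (window_noncovers n k s - window_noncovers n k (s + 1)) ((`) (shifted n k s) ` C)"
  unfolding window_noncovers_diff[OF assms(1,2)]
proof (rule reduces_transfer[OF assms(3), where \<psi> = "shifted n k s"])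
  have inj: "inj_on (shifted n k s) {..<n - k}"
    by (rule inj_on_subset[OF inj_on_shifted]) auto
  then show "inj_on ((`) (shifted n k s)) (Pow {..<n - k})" by (rule inj_on_image_Pow)
  show "shifted n k s v \<in> shifted n k s ` W \<longleftrightarrow> v \<in> W" if "W \<subseteq> {..<n - k}" "v \<in> {..<n - k}" for W v
    using inj_on_image_mem_iff[OF inj that(2,1)] .
qed (use assms in \<open>auto simp: shifted_def\<close>)

text \<open>Here \<open>\<C>\<close> holds the critical faces of earlier stages. Their boundaries
  already lie in the smaller complex, so they can join the untouched part \<open>B\<close> of
  \<open>reduces_homotopy\<close> while stage \<open>s\<close> is collapsed.\<close>

lemma window_noncovers_step:
  assumes "s < k" "k < n"
    and red: "reduces {..<n - k} (block_covers k (n - k) (k - 1 - s)) C"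
    and Cs: "finite \<C>" "\<C> \<inter> window_noncovers n k s = {}" "\<And>c. c \<in> \<C> \<Longrightarrow> finite c"
      "\<And>c \<rho>. c \<in> \<C> \<Longrightarrow> \<rho> \<subset> c \<Longrightarrow> \<rho> \<in> window_noncovers n k (s + 1)"
  defines "\<D> \<equiv> (`) (shifted n k s) ` C"
  shows "geometric_realization (window_noncovers n k s \<union> \<C>) homotopy_equivalent_space
      geometric_realization (window_noncovers n k (s + 1) \<union> (\<D> \<union> \<C>))"
    and "simplicial_complex (window_noncovers n k (s + 1) \<union> (\<D> \<union> \<C>))"
    and "\<D> \<subseteq> window_noncovers n k s - window_noncovers n k (s + 1)"
proof -
  let ?K = "window_noncovers n k s" and ?L = "window_noncovers n k (s + 1)"
  have LK: "?L \<subseteq> ?K" by (rule window_noncovers_mono) simp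
  have cpx: "simplicial_complex (M \<union> \<C>)" if M: "simplicial_complex M" "?L \<subseteq> M" for M
    unfolding simplicial_complex_def
  proof (intro conjI ballI allI impI)
    show "finite (M \<union> \<C>)" using M(1) Cs(1) by (simp add: simplicial_complex_def)
    show "finite \<sigma>" if "\<sigma> \<in> M \<union> \<C>" for \<sigma> using that M(1) Cs(3) by (auto simp: simplicial_complex_def)
    show "\<tau> \<in> M \<union> \<C>" if "\<sigma> \<in> M \<union> \<C>" "\<tau> \<subseteq> \<sigma>" for \<sigma> \<tau>
      using that simplicial_complex_mono[OF M(1), of \<sigma> \<tau>] Cs(4)[of \<sigma> \<tau>] M(2) by blast
  qed
  have eq: "(?L \<union> \<C>) \<union> (?K - ?L) = ?K \<union> \<C>" using LK by blast
  have "simplicial_complex ((?L \<union> \<C>) \<union> \<D>) \<and> \<D> \<subseteq> ?K - ?L \<and>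
    geometric_realization ((?L \<union> \<C>) \<union> (?K - ?L)) homotopy_equivalent_space
    geometric_realization ((?L \<union> \<C>) \<union> \<D>)"
  proof (rule reduces_homotopy)
    show "reduces {..<n} (?K - ?L) \<D>"
      unfolding \<D>_def using reduces_window_noncovers[OF assms(1,2) red] .
    show "simplicial_complex (?L \<union> \<C>)" by (rule cpx[OF simplicial_complex_window_noncovers]) simp
    show "simplicial_complex ((?L \<union> \<C>) \<union> (?K - ?L))"
      unfolding eq by (rule cpx[OF simplicial_complex_window_noncovers LK])
    show "(?L \<union> \<C>) \<inter> (?K - ?L) = {}" using Cs(2) by blast
    show "{} \<notin> ?K - ?L" using empty_in_window_noncovers[of "s + 1" n k] assms by simp
  qed
  moreover have "(?L \<union> \<C>) \<union> \<D> = ?L \<union> (\<D> \<union> \<C>)" by blast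
  ultimately show "geometric_realization (?K \<union> \<C>) homotopy_equivalent_space geometric_realization (?L \<union> (\<D> \<union> \<C>))"
    "simplicial_complex (?L \<union> (\<D> \<union> \<C>))" "\<D> \<subseteq> ?K - ?L"
    unfolding eq by simp_all
qed

text \<open>For a nonzero residue \<open>t\<close>, stage \<open>s'\<close> has
  \<open>k - c = s' + 1\<close>, so only stage \<open>t - 1\<close> can leave a critical face. The
  last hypothesis says that it is not among the stages \<open>j\<close>, ..., \<open>s - 1\<close>
  passed here.\<close>

lemma window_noncovers_drop:
  assumes "j \<le> s" "s \<le> k" "k < n" "n = (q + 1) * (k + 1) + t" "0 < t" "t \<le> k" "t \<notin> {j + 1..s}"
  shows "geometric_realization (window_noncovers n k j) homotopy_equivalent_space
    geometric_realization (window_noncovers n k s)"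
  using assms(1,2,7)
proof (induction s rule: dec_induct)
  case base
  show ?case by (rule homotopy_equivalent_space_refl)
next
  case (step s)
  have eq: "n - k = q * (k + 1) + t + 1" using assms by simp
  have "reduces {..<n - k} (block_covers k (n - k) (k - 1 - s)) {}"
    unfolding eq using step assms by (intro reduces_block_covers_none) auto
  then have "geometric_realization (window_noncovers n k s) homotopy_equivalent_space
    geometric_realization (window_noncovers n k (s + 1))"
    using window_noncovers_step(1)[of s k n "{}" "{}"] step assms by simp
  moreover have "geometric_realization (window_noncovers n k j) homotopy_equivalent_space
    geometric_realization (window_noncovers n k s)"
    using step by auto
  ultimately show ?case using homotopy_eqv_trans by fastforce
qed

text \<open>One cell is collected per stage. The invariant places the boundaries in the final
  complex rather than the current one, so that it remains usable at all later stages.\<close>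

lemma window_noncovers_even:
  assumes "j < k" "k < n" "n = (q + 1) * (k + 1)"
  shows "geometric_realization (window_noncovers n k j) homotopy_equivalent_space wedge_of_spheres (k - j) (2 * q)"
proof -
  have eq: "n - k = q * (k + 1) + 1" using assms by simp
  have "\<exists>\<C>. finite \<C> \<and> \<C> \<inter> window_noncovers n k s = {} \<and> card \<C> = s - j \<and>
      simplicial_complex (window_noncovers n k s \<union> \<C>) \<and>
      (\<forall>c\<in>\<C>. card c = 2 * q + 1 \<and> (\<forall>\<rho>. \<rho> \<subset> c \<longrightarrow> \<rho> \<in> window_noncovers n k k)) \<and>
      geometric_realization (window_noncovers n k j) homotopy_equivalent_space
      geometric_realization (window_noncovers n k s \<union> \<C>)" if "j \<le> s" "s \<le> k" for s
    using that
  proof (induction s rule: dec_induct)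
    case base
    show ?case
      by (intro exI[of _ "{}"]) (simp add: simplicial_complex_window_noncovers homotopy_equivalent_space_refl)
  next
    case (step s)
    then obtain \<C> where C: "finite \<C>" "\<C> \<inter> window_noncovers n k s = {}" "card \<C> = s - j"
      "\<And>c. c \<in> \<C> \<Longrightarrow> card c = 2 * q + 1"
      "\<And>c \<rho>. c \<in> \<C> \<Longrightarrow> \<rho> \<subset> c \<Longrightarrow> \<rho> \<in> window_noncovers n k k"
      "geometric_realization (window_noncovers n k j) homotopy_equivalent_space
        geometric_realization (window_noncovers n k s \<union> \<C>)"
      by (metis Suc_leD)
    have s: "s < k" using step by simp
    then have "k - 1 - s < k" by linarith
    from reduces_block_covers_odd[OF this, of q] obtain C where
      red: "reduces {..<n - k} (block_covers k (n - k) (k - 1 - s)) {C}"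
      and CL: "C \<subseteq> {..<n - k}" "card C = 2 * q + 1"
        "\<And>x. x \<in> C \<Longrightarrow> \<not> {k - 1 - s..<n - k + (k - 1 - s)} \<subseteq> blocks k (C - {x})"
      unfolding eq by blast
    let ?c = "shifted n k s ` C"
    have sub: "window_noncovers n k k \<subseteq> window_noncovers n k (s + 1)"
      using s by (intro window_noncovers_mono) simp
    have fin: "finite c" if "c \<in> \<C>" for c using C(4)[OF that] by (auto intro: card_ge_0_finite)
    have bd: "\<rho> \<in> window_noncovers n k (s + 1)" if "c \<in> \<C>" "\<rho> \<subset> c" for c \<rho>
      using C(5)[OF that] sub by blast
    note st = window_noncovers_step[OF s assms(2) red C(1,2) fin bd]
    have c: "?c \<in> window_noncovers n k s" "?c \<notin> window_noncovers n k (s + 1)" using st(3) by auto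
    have inj: "inj_on (shifted n k s) C"
      by (rule inj_on_subset[OF inj_on_shifted]) (use CL(1) in auto)
    \<comment> \<open>A proper subset lacks some vertex \<open>x\<close>, which opens a gap
      \<open>a \<ge> k - 1 - s\<close>; the window \<open>s + 1 + a \<ge> k\<close> is then
      missed.\<close>
    have "\<rho> \<in> window_noncovers n k k" if \<rho>: "\<rho> \<subset> ?c" for \<rho>
    proof -
      obtain x where x: "x \<in> C" "\<rho> \<subseteq> ?c - {shifted n k s x}" using \<rho> by blast
      then have sub: "\<rho> \<subseteq> shifted n k s ` (C - {x})" by blast
      obtain a where a: "k - 1 - s \<le> a" "a < n - k + (k - 1 - s)" "a \<notin> blocks k (C - {x})"
        using CL(3)[OF x(1)] by force
      have "C - {x} \<subseteq> {..<n - k}" using CL(1) by blast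
      moreover have "a < n - 1 - s" using a(2) s assms(2) by linarith
      ultimately have "shifted n k s ` (C - {x}) \<inter> tight_edge n k (s + 1 + a) = {}"
        using shifted_meets_edge[OF s assms(2)] a(3) by blast
      moreover have "s + 1 + a \<in> {k..<n}" using a(1) \<open>a < n - 1 - s\<close> by auto
      moreover have "\<rho> \<subseteq> {..<n}" using c(1) \<rho> by (auto simp: in_window_noncovers)
      ultimately show ?thesis using sub unfolding in_window_noncovers by blast
    qed
    with C(5) have bd': "\<rho> \<in> window_noncovers n k k" if "c \<in> insert ?c \<C>" "\<rho> \<subset> c" for c \<rho>
      using that by blast
    show ?case
    proof (intro exI[of _ "insert ?c \<C>"] conjI ballI allI impI)
      show "finite (insert ?c \<C>)" using C(1) by simp
      show "insert ?c \<C> \<inter> window_noncovers n k (Suc s) = {}"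
        using c(2) C(2) window_noncovers_mono[of s "Suc s" n k] by auto
      show "card (insert ?c \<C>) = Suc s - j"
        using C(1,2,3) c(1) step(1) by (subst card_insert_disjoint) auto
      show "simplicial_complex (window_noncovers n k (Suc s) \<union> insert ?c \<C>)" using st(2) by simp
      show "card c = 2 * q + 1" if "c \<in> insert ?c \<C>" for c
        using that C(4)[of c] card_image[OF inj] CL(2) by auto
      show "\<rho> \<in> window_noncovers n k k" if "c \<in> insert ?c \<C>" "\<rho> \<subset> c" for c \<rho>
        using bd'[OF that] .
      show "geometric_realization (window_noncovers n k j) homotopy_equivalent_space
        geometric_realization (window_noncovers n k (Suc s) \<union> insert ?c \<C>)"
        using homotopy_eqv_trans[OF C(6) st(1)] by simp
    qed
  qed
  from this[of k] obtain \<C> where C: "finite \<C>" "\<C> \<inter> window_noncovers n k k = {}" "card \<C> = k - j"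
      "simplicial_complex (window_noncovers n k k \<union> \<C>)" "\<And>c. c \<in> \<C> \<Longrightarrow> card c = Suc (2 * q)"
      "geometric_realization (window_noncovers n k j) homotopy_equivalent_space
        geometric_realization (window_noncovers n k k \<union> \<C>)"
    using assms(1) by auto
  have "\<C> \<noteq> {}" using C(3) assms(1) by auto
  then have "geometric_realization (window_noncovers n k k \<union> \<C>) homotopy_equivalent_space wedge_of_spheres (card \<C>) (2 * q)"
    using C assms
    by (intro homotopy_equivalent_wedge_of_spheres simplicial_complex_window_noncovers
        contractible_window_noncovers) auto
  then show ?thesis using homotopy_eqv_trans[OF C(6)] C(3) by simp
qed

text \<open>Nonemptiness, a separate clause of \<open>contractible_complex\<close>, is read off from
  the inclusion.\<close>

lemma contractible_complex_homotopy:
  assumes "geometric_realization K homotopy_equivalent_space geometric_realization L"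
    and "contractible_complex L" "L \<subseteq> K"
  shows "contractible_complex K"
proof -
  have "topspace (geometric_realization K) \<noteq> {}"
    using assms(2) realization_mono[OF assms(3)] unfolding contractible_complex_def by blast
  then show ?thesis
    using homotopy_equivalent_space_contractibility[OF assms(1)] assms(2)
    unfolding contractible_complex_def by blast
qed

text \<open>All stages but \<open>t - 1\<close> collapse completely. Those after it make
  \<open>window_noncovers n k t\<close> contractible, so the single cell of stage
  \<open>t - 1\<close> becomes the sphere.\<close>

lemma window_noncovers_odd:
  assumes "j < t" "t \<le> k" "k < n" "n = (q + 1) * (k + 1) + t"
  shows "geometric_realization (window_noncovers n k j) homotopy_equivalent_space nsphere (2 * q + 1)"
proof -
  define s where "s = t - 1"
  have s: "s < k" "j \<le> s" "t = s + 1" using assms by (auto simp: s_def)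
  have "k - (k - 1 - s) = t" using s by linarith
  moreover have eq: "n - k = q * (k + 1) + t + 1" using assms by simp
  moreover have "k - 1 - s < k" using s by linarith
  ultimately obtain C where
    red: "reduces {..<n - k} (block_covers k (n - k) (k - 1 - s)) {C}"
    and C: "C \<subseteq> {..<n - k}" "card C = 2 * q + 2"
    using reduces_block_covers_even[of "k - 1 - s" k q] by auto
  let ?c = "shifted n k s ` C"
  have st: "geometric_realization (window_noncovers n k s) homotopy_equivalent_space
      geometric_realization (window_noncovers n k (s + 1) \<union> {?c})"
    "simplicial_complex (window_noncovers n k (s + 1) \<union> {?c})" "?c \<notin> window_noncovers n k (s + 1)"
    using window_noncovers_step[OF s(1) assms(3) red, of "{}"] by auto
  have "inj_on (shifted n k s) C"
    by (rule inj_on_subset[OF inj_on_shifted]) (use C(1) in auto)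
  then have card: "card ?c = Suc (2 * q + 1)" using C(2) by (simp add: card_image)
  have "geometric_realization (window_noncovers n k (s + 1)) homotopy_equivalent_space
      geometric_realization (window_noncovers n k k)"
    using s assms by (intro window_noncovers_drop[where q = q and t = t]) auto
  then have "contractible_complex (window_noncovers n k (s + 1))"
    using s assms by (elim contractible_complex_homotopy)
      (auto intro!: contractible_window_noncovers window_noncovers_mono)
  then have "geometric_realization (window_noncovers n k (s + 1) \<union> {?c}) homotopy_equivalent_space
      wedge_of_spheres (card {?c}) (2 * q + 1)"
    using st card by (intro homotopy_equivalent_wedge_of_spheres simplicial_complex_window_noncovers) auto
  also have "card {?c} = 1" by simp
  also have "wedge_of_spheres 1 (2 * q + 1) homotopy_equivalent_space nsphere (2 * q + 1)"
    by (intro homeomorphic_imp_homotopy_equivalent_space wedge_of_one_sphere)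
  finally have "geometric_realization (window_noncovers n k (s + 1) \<union> {?c}) homotopy_equivalent_space nsphere (2 * q + 1)" .
  moreover have "geometric_realization (window_noncovers n k j) homotopy_equivalent_space
      geometric_realization (window_noncovers n k s)"
    using s assms by (intro window_noncovers_drop[where q = q and t = t]) auto
  ultimately show ?thesis using st(1) homotopy_eqv_trans by blast
qed

theorem theorem3p4:
  fixes n k j :: nat
  assumes "0 < k" and "k < n" and "j \<le> n"
  defines "K \<equiv> noncover_complex {..<n} (tight_cycle_del n k j)"
  shows "(j = n \<longrightarrow> K = {}) \<and>
    (k \<le> j \<and> j < n \<longrightarrow> contractible_complex K) \<and>
    (j \<le> k - 1 \<longrightarrow>
      (\<forall>q. n = (q + 1) * (k + 1) \<longrightarrow>
        geometric_realization K homotopy_equivalent_space wedge_of_spheres (k - j) (2 * q)) \<and>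
      (\<forall>q t. n = (q + 1) * (k + 1) + t \<and> j < t \<and> t \<le> k \<longrightarrow>
        geometric_realization K homotopy_equivalent_space nsphere (2 * q + 1)) \<and>
      ((\<nexists>q. n = (q + 1) * (k + 1)) \<and>
       (\<nexists>q t. n = (q + 1) * (k + 1) + t \<and> j < t \<and> t \<le> k) \<longrightarrow>
        contractible_complex K))"
proof (intro conjI impI allI)
  have K: "K = window_noncovers n k j"
    unfolding K_def using noncover_tight_cycle_del[OF assms(1-3)] .
  show "K = {}" if "j = n" using that by (auto simp: K in_window_noncovers)
  show "contractible_complex K" if "k \<le> j \<and> j < n"
    using that contractible_window_noncovers assms(1) unfolding K by blast
  assume "j \<le> k - 1"
  then have jk: "j < k" using assms(1) by linarith
  show "geometric_realization K homotopy_equivalent_space wedge_of_spheres (k - j) (2 * q)"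
    if "n = (q + 1) * (k + 1)" for q
    using window_noncovers_even[OF jk assms(2) that] unfolding K .
  show "geometric_realization K homotopy_equivalent_space nsphere (2 * q + 1)"
    if "n = (q + 1) * (k + 1) + t \<and> j < t \<and> t \<le> k" for q t
    using window_noncovers_odd[of j t k n q] that assms(2) unfolding K by blast
  assume none: "(\<nexists>q. n = (q + 1) * (k + 1)) \<and> (\<nexists>q t. n = (q + 1) * (k + 1) + t \<and> j < t \<and> t \<le> k)"
  \<comment> \<open>The subtraction is exact because \<open>n > k\<close> makes the quotient
    positive. In the case left over \<open>0 < t \<le> j\<close>, so the critical stage
    \<open>t - 1\<close> lies before \<open>j\<close> and every stage from \<open>j\<close> on
    collapses.\<close>
  define q t where "q = n div (k + 1) - 1" and "t = n mod (k + 1)"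
  have "0 < n div (k + 1)" using assms(2) by (simp add: div_greater_zero_iff)
  then have "q + 1 = n div (k + 1)" by (simp add: q_def)
  then have n: "n = (q + 1) * (k + 1) + t" unfolding t_def by (simp only: div_mult_mod_eq)
  have "t < k + 1" unfolding t_def by simp
  then have "t \<le> k" by linarith
  moreover have "0 < t" using none n by (metis add.right_neutral neq0_conv)
  moreover have "t \<le> j"
  proof (rule ccontr)
    assume "\<not> t \<le> j"
    then have "j < t" by linarith
    then show False using none n \<open>t \<le> k\<close> by blast
  qed
  ultimately have "geometric_realization K homotopy_equivalent_space
      geometric_realization (window_noncovers n k k)"
    unfolding K using n jk assms(2) by (intro window_noncovers_drop[where q = q and t = t]) auto
  then show "contractible_complex K"
    using jk assms(1-3) unfolding K
    by (elim contractible_complex_homotopy) (auto intro!: contractible_window_noncovers window_noncovers_mono)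
qed

end
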